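(* Let $(R,\mathfrak{m})$ be a Noetherian local ring and $J$ an ideal of $R$. Let $f_1,\ldots,f_r$ be a $J$-filter regular sequence of $R$ and $I=(f_1,\ldots,f_r)$. Let $$a_i=a_J\big(((f_1,\ldots,f_{i-1}):f_i)/(f_1,\ldots,f_{i-1})\big)\qquad\text{for } i=1,\ldots,r.$$ Set $$B_r=\begin{cases} a_1, & r=1,\\ a_1+a_2, & r=2,\\ \displaystyle\max_{2\le i\le r}\{a_1+\cdots+a_{i-1}+2a_i\}, & r\ge 3,\end{cases}$$ and $$N=\max\{B_r,\ \mathrm{ar}_J(f_1),\ \ldots,\ \mathrm{ar}_J(f_1,\ldots,f_r)\}+1.$$ Then for every $I'=(f_1',\ldots,f_r')$, where $f_i'=f_i+\varepsilon_i$ with $\varepsilon_i\in J^N$ for $i=1,\ldots,r$, we have: (i) $f_1',\ldots,f_r'$ is a $J$-filter regular sequence and $$a_J\big(((f_1',\ldots,f_{i-1}'):f_i')/(f_1',\ldots,f_{i-1}')\big)=a_i\qquad\text{for } i=1,\ldots,r.$$ (ii) $\mathrm{in}(f_1',\ldots,f_i')=\mathrm{in}(f_1,\ldots,f_i)$ for each $i=1,\ldots,r$. (iii) In particular, $\mathrm{in}(I')=\mathrm{in}(I)$, $\mathrm{gr}_J(R/I')\cong\mathrm{gr}_J(R/I)$, and $\mathrm{ar}_J(I')=\mathrm{ar}_J(I)$.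
   Context: Let $(R,\mathfrak m)$ be a Noetherian local ring and $J$ an ideal of $R$. - For a finitely generated $R$-module $M$, the $J$-Loewy length is $a_J(M)=\inf\{n\ge 0\mid J^nM=0\}$, with $a_J(M)=\infty$ if no such $n$ exists. - A sequence $f_1,\ldots,f_r$ in $R$ is $J$-filter regular if $a_J\big(((f_1,\ldots,f_{i-1}):f_i)/(f_1,\ldots,f_{i-1})\big)<\infty$ for every $i=1,\ldots,r$ (for $i=1$ the ideal $(f_1,\ldots,f_{i-1})$ is $0$). - For an ideal $I$ of $R$, $\mathrm{gr}_J(R/I)=\bigoplus_{n\ge 0}(J^n+I)/(J^{n+1}+I)$ is the associated graded ring, and $\mathrm{in}(I)$ is the initial ideal of $I$ in $\mathrm{gr}_J(R)=\bigoplus_{n\ge0}J^n/J^{n+1}$, i.e. the homogeneous ideal $\bigoplus_{n\ge 0}\big((I\cap J^n)+J^{n+1}\big)/J^{n+1}$, so that $\mathrm{gr}_J(R/I)\cong \mathrm{gr}_J(R)/\mathrm{in}(I)$. One writes $\mathrm{in}(g_1,\ldots,g_s)$ for the initial ideal of the ideal $(g_1,\ldots,g_s)$. - The Artin–Rees number $\mathrm{ar}_J(I)$ is the least integer $c\ge 0$ such that $J^{n+1}\cap I=J(J^n\cap I)$ for all $n\ge c$; $\mathrm{ar}_J(g_1,\ldots,g_s)$ means $\mathrm{ar}_J((g_1,\ldots,g_s))$.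
   Formalization: The ideal J is assumed proper (J ≠ R). For J = R the claim always fails: ε_1 = −f_1 is then allowed, giving f_1' = 0, and (0:0)/0 = R has infinite J-Loewy length. *)

theory Defs
  imports "HOL-Algebra.Algebra" "HOL-Library.Extended_Nat"
begin

locale noetherian_local_ring = cring R + noetherian_ring R for R (structure) +
  fixes \<mm> :: "'a set"
  assumes maximal: "maximalideal \<mm> R"
    and unique_maximal: "maximalideal M R \<Longrightarrow> M = \<mm>"

text \<open>Powers are taken in the library's monoid of ideals, so the zeroth power is the whole ring.\<close>

definition ideal_pow :: "('a, 'b) ring_scheme \<Rightarrow> 'a set \<Rightarrow> nat \<Rightarrow> 'a set" where
  "ideal_pow R J n = J [^]\<^bsub>ideals_set R\<^esub> n"

definition colon :: "('a, 'b) ring_scheme \<Rightarrow> 'a set \<Rightarrow> 'a \<Rightarrow> 'a set" where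
  "colon R I x = {y \<in> carrier R. y \<otimes>\<^bsub>R\<^esub> x \<in> I}"

text \<open>
  The quotient \<open>A / B\<close> of two ideals \<open>B \<subseteq> A\<close> as an \<open>R\<close>-module whose elements are cosets of \<open>B\<close>.
  The record type of modules extends that of rings, so its ring multiplication and unit have to
  be filled in; they play no role.
\<close>

definition quot_module :: "('a, 'b) ring_scheme \<Rightarrow> 'a set \<Rightarrow> 'a set \<Rightarrow> ('a, 'a set) module" where
  "quot_module R A B =
    \<lparr>carrier = (\<lambda>x. B +>\<^bsub>R\<^esub> x) ` A, monoid.mult = undefined, one = undefined,
     ring.zero = B, add = set_add R,
     smult = (\<lambda>r C. (\<Union>x\<in>C. B +>\<^bsub>R\<^esub> (r \<otimes>\<^bsub>R\<^esub> x)))\<rparr>"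

definition ideal_smult :: "'a set \<Rightarrow> ('a, 'm, 'c) module_scheme \<Rightarrow> 'm set" where
  "ideal_smult K M = generate (add_monoid M) {k \<odot>\<^bsub>M\<^esub> m | k m. k \<in> K \<and> m \<in> carrier M}"

text \<open>The infimum of the empty set in \<^typ>\<open>enat\<close> is \<open>\<infinity>\<close>.\<close>

definition loewy_length ::
  "('a, 'b) ring_scheme \<Rightarrow> 'a set \<Rightarrow> ('a, 'm, 'c) module_scheme \<Rightarrow> enat" where
  "loewy_length R J M = Inf {enat n | n. ideal_smult (ideal_pow R J n) M = {\<zero>\<^bsub>M\<^esub>}}"

text \<open>
  A sequence \<open>f\<^sub>1, \<dots>, f\<^sub>r\<close> is a function \<open>f\<close> on the natural numbers of which only the values at
  \<open>1, \<dots>, r\<close> matter. The empty set generates the zero ideal.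
\<close>

definition seq_ideal :: "('a, 'b) ring_scheme \<Rightarrow> (nat \<Rightarrow> 'a) \<Rightarrow> nat \<Rightarrow> 'a set" where
  "seq_ideal R f i = Idl\<^bsub>R\<^esub> (f ` {1..i})"

definition colon_loewy ::
  "('a, 'b) ring_scheme \<Rightarrow> 'a set \<Rightarrow> (nat \<Rightarrow> 'a) \<Rightarrow> nat \<Rightarrow> enat" where
  "colon_loewy R J f i =
    loewy_length R J
      (quot_module R (colon R (seq_ideal R f (i - 1)) (f i)) (seq_ideal R f (i - 1)))"

definition filter_regular ::
  "('a, 'b) ring_scheme \<Rightarrow> 'a set \<Rightarrow> (nat \<Rightarrow> 'a) \<Rightarrow> nat \<Rightarrow> bool" where
  "filter_regular R J f r \<longleftrightarrow>
    f ` {1..r} \<subseteq> carrier R \<and> (\<forall>i\<in>{1..r}. colon_loewy R J f i < \<infinity>)"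

text \<open>
  Over a Noetherian ring the Artin-Rees lemma provides some \<open>c\<close> of this kind, so the least one exists.
\<close>

definition artin_rees :: "('a, 'b) ring_scheme \<Rightarrow> 'a set \<Rightarrow> 'a set \<Rightarrow> nat" where
  "artin_rees R J I =
    (LEAST c. \<forall>n\<ge>c. ideal_pow R J (n + 1) \<inter> I = J \<cdot>\<^bsub>R\<^esub> (ideal_pow R J n \<inter> I))"

text \<open>
  The direct sum over all \<open>n\<close> of the quotients \<open>A n / B n\<close>: an element is a sequence of cosets
  of the \<open>B n\<close>, almost all of them zero.
\<close>

definition quot_dsum ::
  "('a, 'b) ring_scheme \<Rightarrow> (nat \<Rightarrow> 'a set) \<Rightarrow> (nat \<Rightarrow> 'a set) \<Rightarrow> (nat \<Rightarrow> 'a set) set" where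
  "quot_dsum R A B =
    {u. (\<forall>n. u n \<in> (\<lambda>x. B n +>\<^bsub>R\<^esub> x) ` A n) \<and> finite {n. u n \<noteq> B n}}"

text \<open>
  \<open>assoc_graded R J I\<close> is the associated graded ring of \<open>R / I\<close> with respect to \<open>J\<close>; the
  component of degree \<open>n\<close> is \<open>(J\<^sup>n + I) / (J\<^sup>n\<^sup>+\<^sup>1 + I)\<close>. The degree \<open>n\<close> component of a product is
  the sum of the classes of \<open>x i \<otimes> y (n - i)\<close>, where \<open>x i\<close> and \<open>y j\<close> are representatives of the
  components of the factors; the definition collects the results for all choices of
  representatives, which together form one coset.
\<close>

definition gr_filt :: "('a, 'b) ring_scheme \<Rightarrow> 'a set \<Rightarrow> 'a set \<Rightarrow> nat \<Rightarrow> 'a set" where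
  "gr_filt R J I n = ideal_pow R J n <+>\<^bsub>R\<^esub> I"

definition assoc_graded ::
  "('a, 'b) ring_scheme \<Rightarrow> 'a set \<Rightarrow> 'a set \<Rightarrow> (nat \<Rightarrow> 'a set) ring" where
  "assoc_graded R J I =
    \<lparr>carrier = quot_dsum R (gr_filt R J I) (\<lambda>n. gr_filt R J I (n + 1)),
     monoid.mult = (\<lambda>u v n. {(\<Oplus>\<^bsub>R\<^esub>i\<in>{..n}. x i \<otimes>\<^bsub>R\<^esub> y (n - i)) \<oplus>\<^bsub>R\<^esub> z | x y z.
                 (\<forall>i\<le>n. x i \<in> u i \<and> y i \<in> v i) \<and> z \<in> gr_filt R J I (n + 1)}),
     one = (\<lambda>n. if n = 0 then gr_filt R J I 1 +>\<^bsub>R\<^esub> \<one>\<^bsub>R\<^esub> else gr_filt R J I (n + 1)),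
     ring.zero = (\<lambda>n. gr_filt R J I (n + 1)),
     add = (\<lambda>u v n. u n <+>\<^bsub>R\<^esub> v n)\<rparr>"

definition gr_component ::
  "('a, 'b) ring_scheme \<Rightarrow> 'a set \<Rightarrow> 'a set \<Rightarrow> nat \<Rightarrow> (nat \<Rightarrow> 'a set) set" where
  "gr_component R J I n =
    {u \<in> carrier (assoc_graded R J I). \<forall>k. k \<noteq> n \<longrightarrow> u k = \<zero>\<^bsub>assoc_graded R J I\<^esub> k}"

definition gr_isomorphic :: "('a, 'b) ring_scheme \<Rightarrow> 'a set \<Rightarrow> 'a set \<Rightarrow> 'a set \<Rightarrow> bool" where
  "gr_isomorphic R J I I' \<longleftrightarrow>
    (\<exists>h \<in> ring_iso (assoc_graded R J I) (assoc_graded R J I').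
       \<forall>n. h ` gr_component R J I n = gr_component R J I' n)"

text \<open>
  The initial ideal of \<open>I\<close>, a subset of the carrier of \<open>assoc_graded R J {\<zero>}\<close>, whose component of
  degree \<open>n\<close> is \<open>J\<^sup>n / J\<^sup>n\<^sup>+\<^sup>1\<close>.
\<close>

definition initial_ideal ::
  "('a, 'b) ring_scheme \<Rightarrow> 'a set \<Rightarrow> 'a set \<Rightarrow> (nat \<Rightarrow> 'a set) set" where
  "initial_ideal R J I =
    quot_dsum R (\<lambda>n. (I \<inter> ideal_pow R J n) <+>\<^bsub>R\<^esub> ideal_pow R J (n + 1))
      (\<lambda>n. ideal_pow R J (n + 1))"

definition loewy_bound :: "nat \<Rightarrow> (nat \<Rightarrow> nat) \<Rightarrow> nat" where
  "loewy_bound r a =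
    (if r = 1 then a 1
     else if r = 2 then a 1 + a 2
     else Max ((\<lambda>i. (\<Sum>j = 1..i - 1. a j) + 2 * a i) ` {2..r}))"

end

theory Submission
  imports Defs
begin

no_notation Sum_Type.Plus (infixr \<open><+>\<close> 65)

text \<open>
  The elements of the sequence are perturbed one at a time. If \<open>f\<close> is replaced by \<open>f + e\<close> modulo an
  ideal \<open>K\<close> with \<open>J\<^sup>s (K : f) \<subseteq> K\<close> and \<open>e\<close> lies in a power of \<open>J\<close> beyond \<open>s\<close> and beyond the Artin-Rees
  number of \<open>K + (f)\<close>, then \<open>K : f\<close> and the initial ideal of \<open>K + (f)\<close> do not change, by the Artin-Rees
  property and Krull's intersection theorem. To apply this to \<open>f\<^sub>j\<close> modulo the other elements of
  \<open>f\<^sub>1, \<dots>, f\<^sub>i\<close>, one uses that \<open>f\<^sub>j\<close> can be moved to the end of the sequence at the expense of the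
  exponent \<open>a\<^sub>1 + \<dots> + a\<^sub>i\<close>, which annihilates the first Koszul homology. That the later Loewy lengths
  survive the perturbation follows from a linear map between the old and the new colon ideals that is
  surjective by Nakayama's lemma. Since the Artin-Rees number can be read off from the initial ideal,
  all hypotheses persist from one perturbation to the next.
\<close>

subsection \<open>Ideal arithmetic\<close>

text \<open>The Loewy lengths control colons over initial segments only, and a colon that comes
  after the changed element moves with it. If \<open>g\<close> follows \<open>f\<close>, the ideal
  \<open>(K + (f)) : g\<close> is in general not preserved when \<open>f\<close> becomes
  \<open>f + e\<close>; only the exponents annihilating it modulo \<open>K + (f)\<close> can be
  compared. The correction used for this needs \<open>e\<close> in \<open>J^a J^(s+1)\<close>: the
  factor \<open>J^a\<close> brings an element of the colon into \<open>K + (f)\<close>,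
  \<open>J^s\<close> removes the ambiguity in the resulting coefficient of \<open>f\<close>, and the
  remaining \<open>J\<close> makes the correction of an element of \<open>K : g\<close> land in
  \<open>J (K : g)\<close>, as Nakayama's lemma requires. With \<open>s = a_1 + ... + a_k\<close>
  and \<open>a = a_(k+1)\<close> this costs \<open>s + a + 1\<close>, which is at most
  \<open>N\<close> because \<open>a_1 + ... + a_r <= B_r < N\<close>. The same summand 1 in
  \<open>N\<close> gives \<open>N > c\<close> for the Artin-Rees numbers \<open>c\<close>, so each
  approximation step gains one power of \<open>J\<close>. The comparison in the other direction
  perturbs \<open>f + e\<close> by \<open>- e\<close>.\<close>

locale noetherian_cring = cring R + noetherian_ring R for R (structure)

sublocale noetherian_local_ring \<subseteq> noetherian_cring
  by unfold_locales

context cring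
begin

lemma ideal_subset: "ideal I R \<Longrightarrow> I \<subseteq> carrier R"
  by (auto intro: ideal.Icarr)

lemma ideal_zero: "ideal I R \<Longrightarrow> \<zero> \<in> I"
  by (simp add: additive_subgroup.zero_closed ideal.axioms(1))

lemma ideal_add: "ideal I R \<Longrightarrow> x \<in> I \<Longrightarrow> y \<in> I \<Longrightarrow> x \<oplus> y \<in> I"
  by (simp add: additive_subgroup.a_closed ideal.axioms(1))

lemma ideal_uminus: "ideal I R \<Longrightarrow> x \<in> I \<Longrightarrow> \<ominus> x \<in> I"
  by (simp add: additive_subgroup.a_inv_closed ideal.axioms(1))

lemma ideal_diff: "ideal I R \<Longrightarrow> x \<in> I \<Longrightarrow> y \<in> I \<Longrightarrow> x \<ominus> y \<in> I"
  by (simp add: a_minus_def ideal_add ideal_uminus)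

lemma idealI':
  assumes "I \<subseteq> carrier R" "\<zero> \<in> I"
    and add: "\<And>x y. x \<in> I \<Longrightarrow> y \<in> I \<Longrightarrow> x \<oplus> y \<in> I"
    and mult: "\<And>c x. c \<in> carrier R \<Longrightarrow> x \<in> I \<Longrightarrow> c \<otimes> x \<in> I"
  shows "ideal I R"
proof (rule idealI[OF ring_axioms])
  have "\<ominus> x \<in> I" if "x \<in> I" for x
    using mult[of "\<ominus> \<one>" x] that assms(1) by (auto simp: l_minus)
  then show "subgroup I (add_monoid R)"
    using assms by (intro subgroup.intro) (auto simp: a_inv_def[symmetric])
  show "a \<otimes> x \<in> I" if "a \<in> I" "x \<in> carrier R" for a x
    using mult[OF that(2,1)] that assms(1) by (metis m_comm subsetD)
qed (use mult in auto)

lemma set_addE: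
  assumes "x \<in> A <+> B"
  obtains a b where "a \<in> A" "b \<in> B" "x = a \<oplus> b"
  using assms by (auto simp: set_add_def')

lemma set_addI: "a \<in> A \<Longrightarrow> b \<in> B \<Longrightarrow> a \<oplus> b \<in> A <+> B"
  by (auto simp: set_add_def')

lemma set_add_left: "ideal A R \<Longrightarrow> ideal B R \<Longrightarrow> A \<subseteq> A <+> B"
  using set_addI[of _ A \<zero> B] by (auto simp: ideal_zero ideal.Icarr)

lemma set_add_right: "ideal A R \<Longrightarrow> ideal B R \<Longrightarrow> B \<subseteq> A <+> B"
  using set_addI[of \<zero> A _ B] by (auto simp: ideal_zero ideal.Icarr)

lemma set_add_least:
  assumes "ideal C R" "A \<subseteq> C" "B \<subseteq> C"
  shows "A <+> B \<subseteq> C"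
  using assms by (auto elim!: set_addE intro: ideal_add)

lemma set_add_mono: "A \<subseteq> A' \<Longrightarrow> B \<subseteq> B' \<Longrightarrow> A <+> B \<subseteq> A' <+> B'"
  by (auto elim!: set_addE intro: set_addI)

lemma ideal_prod_least:
  assumes "ideal C R" "\<And>a b. a \<in> A \<Longrightarrow> b \<in> B \<Longrightarrow> a \<otimes> b \<in> C"
  shows "A \<cdot> B \<subseteq> C"
proof
  fix x assume "x \<in> A \<cdot> B"
  then show "x \<in> C"
    by induction (auto intro: assms ideal_add)
qed

lemma ideal_prod_mono:
  assumes "A \<subseteq> A'" "B \<subseteq> B'"
  shows "A \<cdot> B \<subseteq> A' \<cdot> B'"
proof
  fix x assume "x \<in> A \<cdot> B"
  then show "x \<in> A' \<cdot> B'"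
    by induction (use assms in \<open>auto intro: ideal_prod.intros\<close>)
qed

lemma cgenideal_iff: "x \<in> PIdl a \<longleftrightarrow> (\<exists>c\<in>carrier R. x = c \<otimes> a)"
  by (auto simp: cgenideal_def)

lemma ideal_image_mult:
  assumes "ideal I R" "x \<in> carrier R"
  shows "ideal ((\<lambda>c. c \<otimes> x) ` I) R"
proof (rule idealI')
  show "(\<lambda>c. c \<otimes> x) ` I \<subseteq> carrier R"
    using assms by (auto dest: ideal.Icarr)
  show "\<zero> \<in> (\<lambda>c. c \<otimes> x) ` I"
    using assms by (intro image_eqI[of _ _ \<zero>]) (auto simp: ideal_zero)
  show "y \<oplus> z \<in> (\<lambda>c. c \<otimes> x) ` I"
    if yz: "y \<in> (\<lambda>c. c \<otimes> x) ` I" "z \<in> (\<lambda>c. c \<otimes> x) ` I" for y z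
  proof -
    obtain c d where "c \<in> I" "d \<in> I" "y = c \<otimes> x" "z = d \<otimes> x"
      using yz by auto
    then show ?thesis
      using assms by (intro image_eqI[of _ _ "c \<oplus> d"])
        (auto simp: ideal_add l_distr ideal.Icarr)
  qed
  show "d \<otimes> y \<in> (\<lambda>c. c \<otimes> x) ` I"
    if "d \<in> carrier R" and y: "y \<in> (\<lambda>c. c \<otimes> x) ` I" for d y
  proof -
    obtain c where "c \<in> I" "y = c \<otimes> x"
      using y by auto
    then show ?thesis
      using assms that by (intro image_eqI[of _ _ "d \<otimes> c"])
        (auto simp: m_assoc ideal.Icarr ideal.I_l_closed)
  qed
qed

lemma genideal_insert:
  assumes "A \<subseteq> carrier R" "a \<in> carrier R"
  shows "Idl (insert a A) = Idl A <+> PIdl a"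
proof
  have *: "ideal (Idl A) R" "ideal (PIdl a) R" "ideal (Idl (insert a A)) R"
    using assms by (auto intro: genideal_ideal cgenideal_ideal)
  show "Idl (insert a A) \<subseteq> Idl A <+> PIdl a"
    using set_add_left[OF *(1,2)] set_add_right[OF *(1,2)] genideal_self[OF assms(1)]
      cgenideal_self[OF assms(2)] add_ideals[OF *(1,2)]
    by (intro genideal_minimal) auto
  have "insert a A \<subseteq> Idl (insert a A)"
    using assms by (intro genideal_self) auto
  then show "Idl A <+> PIdl a \<subseteq> Idl (insert a A)"
    using * by (intro set_add_least genideal_minimal cgenideal_minimal) auto
qed

lemma genideal_empty: "Idl {} = {\<zero>}"
  using genideal_minimal[OF zeroideal, of "{}"] ideal_zero[OF genideal_ideal[of "{}"]] by auto

lemma ideal_pow_0 [simp]: "ideal_pow R J 0 = carrier R"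
  by (simp add: ideal_pow_def ideals_set_def)

lemma ideal_pow_Suc: "ideal_pow R J (Suc n) = ideal_pow R J n \<cdot> J"
  by (simp add: ideal_pow_def ideals_set_def)

lemma ideal_pow_ideal: "ideal J R \<Longrightarrow> ideal (ideal_pow R J n) R"
  by (induction n) (auto simp: ideal_pow_Suc oneideal ideal_prod_is_ideal)

lemma ideal_pow_carrier: "ideal J R \<Longrightarrow> x \<in> ideal_pow R J n \<Longrightarrow> x \<in> carrier R"
  by (rule ideal.Icarr[OF ideal_pow_ideal])

lemma ideal_pow_Suc': "ideal J R \<Longrightarrow> ideal_pow R J (Suc n) = J \<cdot> ideal_pow R J n"
  by (simp add: ideal_pow_Suc ideal_prod_commute ideal_pow_ideal)

lemma ideal_pow_1: "ideal J R \<Longrightarrow> ideal_pow R J (Suc 0) = J"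
  by (simp add: ideal_pow_Suc' ideal_prod_one)

lemma ideal_pow_add:
  assumes "ideal J R"
  shows "ideal_pow R J (m + n) = ideal_pow R J m \<cdot> ideal_pow R J n"
  by (induction n) (simp_all add: assms ideal_pow_Suc ideal_prod_one ideal_pow_ideal ideal_prod_assoc)

lemma ideal_pow_mult:
  assumes "ideal J R" "x \<in> ideal_pow R J m" "y \<in> ideal_pow R J n"
  shows "x \<otimes> y \<in> ideal_pow R J (m + n)"
  by (simp add: assms ideal_pow_add ideal_prod.prod)

lemma ideal_pow_antimono:
  assumes "ideal J R" "m \<le> n"
  shows "ideal_pow R J n \<subseteq> ideal_pow R J m"
proof -
  have "ideal_pow R J (m + (n - m)) \<subseteq> ideal_pow R J m"
    unfolding ideal_pow_add[OF assms(1)] using assms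
    by (intro ideal_prod_least ideal_pow_ideal) (auto intro: ideal.I_r_closed ideal.Icarr ideal_pow_ideal)
  then show ?thesis using assms by simp
qed

lemma colon_ideal:
  assumes "ideal K R" "x \<in> carrier R"
  shows "ideal (colon R K x) R"
  using assms by (intro idealI')
    (auto simp: colon_def ideal_zero ideal_add l_distr m_assoc ideal.I_l_closed)

end

subsection \<open>The Artin-Rees lemma\<close>

text \<open>
  For \<open>J = J\<^sub>0 + (b)\<close>, \<open>bdeg_less R J\<^sub>0 b k m\<close> is the part of \<open>J\<^bsup>m + k\<^esup>\<close> spanned by the products
  \<open>J\<^sub>0\<^bsup>m + k - j\<^esup> b\<^sup>j\<close> with \<open>j < k\<close>. Indexing by \<open>m\<close> rather than by \<open>m + k\<close> avoids subtraction.
\<close>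

primrec bdeg_less :: "('a, 'c) ring_scheme \<Rightarrow> 'a set \<Rightarrow> 'a \<Rightarrow> nat \<Rightarrow> nat \<Rightarrow> 'a set" where
  "bdeg_less R J b 0 = (\<lambda>m. {\<zero>\<^bsub>R\<^esub>})"
| "bdeg_less R J b (Suc k) =
    (\<lambda>m. bdeg_less R J b k (Suc m) <+>\<^bsub>R\<^esub> (\<lambda>c. c \<otimes>\<^bsub>R\<^esub> b [^]\<^bsub>R\<^esub> k) ` ideal_pow R J (Suc m))"

text \<open>Leading coefficients as in Hilbert's basis theorem, with \<open>b\<close> in the role of
  the variable and the family \<open>K\<close> in the role of a graded ideal of the Rees algebra.
  Expansions in powers of \<open>b\<close> are not unique in \<open>R\<close>; every expansion of a
  member of \<open>K (m + k)\<close> contributes.\<close>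

definition lead_ideal ::
  "('a, 'c) ring_scheme \<Rightarrow> 'a set \<Rightarrow> 'a \<Rightarrow> (nat \<Rightarrow> 'a set) \<Rightarrow> nat \<Rightarrow> nat \<Rightarrow> 'a set" where
  "lead_ideal R J b K k m =
    {c \<in> ideal_pow R J m. \<exists>w\<in>bdeg_less R J b k m. c \<otimes>\<^bsub>R\<^esub> b [^]\<^bsub>R\<^esub> k \<oplus>\<^bsub>R\<^esub> w \<in> K (m + k)}"

context cring
begin

context
  fixes J b
  assumes J: "ideal J R" and b: "b \<in> carrier R"
begin

lemma bdeg_less_ideal: "ideal (bdeg_less R J b k m) R"
  by (induction k arbitrary: m)
    (auto simp: zeroideal intro!: add_ideals ideal_image_mult ideal_pow_ideal J b)

lemma bdeg_less_carrier: "w \<in> bdeg_less R J b k m \<Longrightarrow> w \<in> carrier R"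
  by (rule ideal.Icarr[OF bdeg_less_ideal])

lemma bdeg_less_mult_left:
  assumes "j \<in> J" "w \<in> bdeg_less R J b k m"
  shows "j \<otimes> w \<in> bdeg_less R J b k (Suc m)"
  using assms(2)
proof (induction k arbitrary: w m)
  case 0
  then show ?case using assms(1) J by (auto simp: ideal.Icarr)
next
  case (Suc k)
  from Suc.prems obtain v c where v: "v \<in> bdeg_less R J b k (Suc m)"
    and c: "c \<in> ideal_pow R J (Suc m)" and w: "w = v \<oplus> c \<otimes> b [^] k"
    by (auto elim!: set_addE)
  have carr: "j \<in> carrier R" "v \<in> carrier R" "c \<in> carrier R" "b [^] k \<in> carrier R"
    using assms(1) J b v c bdeg_less_carrier ideal_pow_carrier[OF J] by (auto dest: ideal.Icarr)
  have "j \<otimes> w = j \<otimes> v \<oplus> (j \<otimes> c) \<otimes> b [^] k"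
    unfolding w using carr by algebra
  moreover have "j \<otimes> c \<in> ideal_pow R J (Suc (Suc m))"
    using assms(1) c unfolding ideal_pow_Suc'[OF J, of "Suc m"] by (rule ideal_prod.prod)
  ultimately show ?case
    using Suc.IH[OF v] by (auto intro!: set_addI)
qed

lemma bdeg_less_mult_b:
  assumes "w \<in> bdeg_less R J b k m"
  shows "b \<otimes> w \<in> bdeg_less R J b (Suc k) m"
  using assms
proof (induction k arbitrary: w m)
  case 0
  have "ideal (bdeg_less R J b (Suc 0) m) R" by (rule bdeg_less_ideal)
  with 0 show ?case using b by (auto simp: ideal_zero simp del: bdeg_less.simps(2))
next
  case (Suc k)
  from Suc.prems obtain v c where v: "v \<in> bdeg_less R J b k (Suc m)"
    and c: "c \<in> ideal_pow R J (Suc m)" and w: "w = v \<oplus> c \<otimes> b [^] k"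
    by (auto elim!: set_addE)
  have carr: "v \<in> carrier R" "c \<in> carrier R" "b [^] k \<in> carrier R"
    using J b v c bdeg_less_carrier ideal_pow_carrier[OF J] by (auto dest: ideal.Icarr)
  have "b \<otimes> w = b \<otimes> v \<oplus> c \<otimes> b [^] (Suc k)"
    unfolding w nat_pow_Suc using carr b by algebra
  then show ?case
    unfolding bdeg_less.simps(2)[of R J b "Suc k"] using Suc.IH[OF v] c
    by (auto intro!: set_addI simp del: nat_pow_Suc bdeg_less.simps)
qed

text \<open>Binomial expansion of a power of \<open>J + (b)\<close>. The term \<open>b^n\<close> is
  kept apart because its coefficient ranges over \<open>J^0\<close>, the whole ring; it is where the
  descent through the \<open>b\<close>-degrees begins.\<close>

lemma ideal_pow_subset_bdeg:
  "ideal_pow R (J <+> PIdl b) n \<subseteq> bdeg_less R J b n 0 <+> PIdl (b [^] n)"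
proof (induction n)
  case 0
  show ?case
    using set_add_right[OF zeroideal cgenideal_ideal[OF one_closed]]
    by (simp add: cgenideal_eq_genideal genideal_one)
next
  case (Suc n)
  let ?C = "bdeg_less R J b (Suc n) 0 <+> PIdl (b [^] Suc n)"
  have B: "ideal (bdeg_less R J b (Suc n) 0) R" "ideal (PIdl (b [^] Suc n)) R"
    using b by (auto intro!: bdeg_less_ideal cgenideal_ideal simp del: bdeg_less.simps nat_pow_Suc)
  then have C: "ideal ?C R" by (rule add_ideals)
  have sub: "bdeg_less R J b (Suc n) 0 \<subseteq> ?C" "PIdl (b [^] Suc n) \<subseteq> ?C"
    using B by (rule set_add_left set_add_right)+
  have "x \<otimes> y \<in> ?C" if x: "x \<in> ideal_pow R (J <+> PIdl b) n" and y: "y \<in> J <+> PIdl b" for x y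
  proof -
    obtain v c where v: "v \<in> bdeg_less R J b n 0" and c: "c \<in> carrier R" and xe: "x = v \<oplus> c \<otimes> b [^] n"
      using Suc x by (auto elim!: set_addE simp: cgenideal_iff dest!: subsetD)
    obtain j d where j: "j \<in> J" and d: "d \<in> carrier R" and ye: "y = j \<oplus> d \<otimes> b"
      using y by (auto elim!: set_addE simp: cgenideal_iff)
    have carr: "v \<in> carrier R" "j \<in> carrier R" "b [^] n \<in> carrier R"
      using J b v j bdeg_less_carrier by (auto dest: ideal.Icarr)
    have "c \<otimes> j \<in> ideal_pow R J (Suc 0)"
      using j c J by (simp add: ideal_pow_1 ideal.I_l_closed)
    then have 1: "j \<otimes> v \<oplus> (c \<otimes> j) \<otimes> b [^] n \<in> bdeg_less R J b (Suc n) 0"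
      using bdeg_less_mult_left[OF j v] by (auto intro!: set_addI)
    have 2: "d \<otimes> (b \<otimes> v) \<in> bdeg_less R J b (Suc n) 0"
      using bdeg_less_mult_b[OF v] d B(1) by (auto intro: ideal.I_l_closed simp del: bdeg_less.simps)
    have 3: "(c \<otimes> d) \<otimes> b [^] Suc n \<in> PIdl (b [^] Suc n)"
      using c d by (auto simp: cgenideal_iff simp del: nat_pow_Suc)
    have "x \<otimes> y = (j \<otimes> v \<oplus> (c \<otimes> j) \<otimes> b [^] n) \<oplus> d \<otimes> (b \<otimes> v) \<oplus> (c \<otimes> d) \<otimes> b [^] Suc n"
      unfolding xe ye nat_pow_Suc using carr c d b by algebra
    then show ?thesis
      using ideal_add[OF B(1) 1 2] 3 by (auto intro!: set_addI simp del: bdeg_less.simps nat_pow_Suc)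
  qed
  then show ?case
    unfolding ideal_pow_Suc by (intro ideal_prod_least C)
qed

lemma lead_ideal_ideal:
  assumes "\<And>n. ideal (K n) R"
  shows "ideal (lead_ideal R J b K k m) R"
proof (rule idealI')
  note W = bdeg_less_ideal[of k m] and P = ideal_pow_ideal[OF J, of m]
  have bk: "b [^] k \<in> carrier R" using b by simp
  show "lead_ideal R J b K k m \<subseteq> carrier R"
    using P by (auto simp: lead_ideal_def ideal.Icarr)
  show "\<zero> \<in> lead_ideal R J b K k m"
    using P bk assms by (auto simp: lead_ideal_def ideal_zero intro!: bexI[of _ \<zero>] ideal_zero[OF W])
  show "x \<oplus> y \<in> lead_ideal R J b K k m"
    if xy: "x \<in> lead_ideal R J b K k m" "y \<in> lead_ideal R J b K k m" for x y
  proof -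
    obtain v w where v: "v \<in> bdeg_less R J b k m" "x \<otimes> b [^] k \<oplus> v \<in> K (m + k)"
      and w: "w \<in> bdeg_less R J b k m" "y \<otimes> b [^] k \<oplus> w \<in> K (m + k)"
      and p: "x \<in> ideal_pow R J m" "y \<in> ideal_pow R J m"
      using xy by (auto simp: lead_ideal_def)
    have carr: "v \<in> carrier R" "w \<in> carrier R" "x \<in> carrier R" "y \<in> carrier R"
      using v w p P W by (auto dest: ideal.Icarr)
    have "(x \<oplus> y) \<otimes> b [^] k \<oplus> (v \<oplus> w) = (x \<otimes> b [^] k \<oplus> v) \<oplus> (y \<otimes> b [^] k \<oplus> w)"
      using carr bk by algebra
    then show ?thesis
      using v w p ideal_add[OF P] ideal_add[OF W] ideal_add[OF assms]
      by (auto simp: lead_ideal_def intro!: bexI[of _ "v \<oplus> w"])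
  qed
  show "c \<otimes> x \<in> lead_ideal R J b K k m"
    if c: "c \<in> carrier R" and x: "x \<in> lead_ideal R J b K k m" for c x
  proof -
    obtain v where v: "v \<in> bdeg_less R J b k m" "x \<otimes> b [^] k \<oplus> v \<in> K (m + k)"
      and p: "x \<in> ideal_pow R J m"
      using x by (auto simp: lead_ideal_def)
    have carr: "v \<in> carrier R" "x \<in> carrier R"
      using v p P W by (auto dest: ideal.Icarr)
    have "(c \<otimes> x) \<otimes> b [^] k \<oplus> c \<otimes> v = c \<otimes> (x \<otimes> b [^] k \<oplus> v)"
      using carr bk c by algebra
    then show ?thesis
      using v p c ideal.I_l_closed[OF P] ideal.I_l_closed[OF W] ideal.I_l_closed[OF assms]
      by (auto simp: lead_ideal_def intro!: bexI[of _ "c \<otimes> v"])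
  qed
qed

text \<open>Multiplying a member of \<open>K\<close> by an element of \<open>J\<close> multiplies
  its leading coefficient, while multiplying it by \<open>b\<close> only shifts the leading term. So
  each row with fixed \<open>k\<close> is again a family of the kind to which Artin-Rees applies,
  and each column with fixed \<open>m\<close> is an ascending chain.\<close>

lemma lead_ideal_mult:
  assumes K: "\<And>n. ideal (K n) R" and mult: "\<And>n. (J <+> PIdl b) \<cdot> K n \<subseteq> K (Suc n)"
  shows "J \<cdot> lead_ideal R J b K k m \<subseteq> lead_ideal R J b K k (Suc m)"
    and "lead_ideal R J b K k m \<subseteq> lead_ideal R J b K (Suc k) m"
proof -
  have P: "ideal (PIdl b) R" and bk: "b [^] k \<in> carrier R"
    using b by (auto intro: cgenideal_ideal)
  have sub: "J \<subseteq> J <+> PIdl b" "b \<in> J <+> PIdl b"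
    using set_add_left[OF J P] set_add_right[OF J P] cgenideal_self[OF b] by auto
  have KS: "j \<otimes> x \<in> K (Suc n)" if "j \<in> J <+> PIdl b" "x \<in> K n" for j x n
    using mult[of n] ideal_prod.prod[OF that] by blast
  have "j \<otimes> x \<in> lead_ideal R J b K k (Suc m)" if j: "j \<in> J" and x: "x \<in> lead_ideal R J b K k m" for j x
  proof -
    obtain v where v: "v \<in> bdeg_less R J b k m" "x \<otimes> b [^] k \<oplus> v \<in> K (m + k)"
      and p: "x \<in> ideal_pow R J m"
      using x by (auto simp: lead_ideal_def)
    have carr: "v \<in> carrier R" "x \<in> carrier R" "j \<in> carrier R"
      using v p j J bdeg_less_carrier ideal_pow_carrier[OF J] by (auto dest: ideal.Icarr)
    have "(j \<otimes> x) \<otimes> b [^] k \<oplus> j \<otimes> v = j \<otimes> (x \<otimes> b [^] k \<oplus> v)"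
      using carr bk by algebra
    then show ?thesis
      using j KS[OF _ v(2), of j] sub bdeg_less_mult_left[OF j v(1)] ideal_prod.prod[OF j p, of R]
      by (auto simp: lead_ideal_def ideal_pow_Suc'[OF J] intro!: bexI[of _ "j \<otimes> v"])
  qed
  then show "J \<cdot> lead_ideal R J b K k m \<subseteq> lead_ideal R J b K k (Suc m)"
    by (intro ideal_prod_least lead_ideal_ideal K)
  show "lead_ideal R J b K k m \<subseteq> lead_ideal R J b K (Suc k) m"
  proof
    fix x assume x: "x \<in> lead_ideal R J b K k m"
    obtain v where v: "v \<in> bdeg_less R J b k m" "x \<otimes> b [^] k \<oplus> v \<in> K (m + k)"
      and p: "x \<in> ideal_pow R J m"
      using x by (auto simp: lead_ideal_def)
    have carr: "v \<in> carrier R" "x \<in> carrier R"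
      using v p bdeg_less_carrier ideal_pow_carrier[OF J] by (auto dest: ideal.Icarr)
    have "x \<otimes> b [^] Suc k \<oplus> b \<otimes> v = b \<otimes> (x \<otimes> b [^] k \<oplus> v)"
      unfolding nat_pow_Suc using carr bk b by algebra
    then show "x \<in> lead_ideal R J b K (Suc k) m"
      using KS[OF sub(2) v(2)] bdeg_less_mult_b[OF v(1)] p
      by (auto simp: lead_ideal_def simp del: nat_pow_Suc bdeg_less.simps intro!: bexI[of _ "b \<otimes> v"])
  qed
qed

text \<open>A leading coefficient in \<open>J L\<close> is realised inside
  \<open>(J + (b)) K\<close>, not merely inside the next member of \<open>K\<close>; such an element
  can be subtracted without leaving the target of the Artin-Rees inclusion.\<close>

lemma lead_ideal_prod_lift:
  assumes K: "\<And>n. ideal (K n) R" and c: "c \<in> J \<cdot> lead_ideal R J b K k m"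
  shows "\<exists>w\<in>bdeg_less R J b k (Suc m). c \<otimes> b [^] k \<oplus> w \<in> (J <+> PIdl b) \<cdot> K (m + k)"
  using c
proof induction
  case (prod j x)
  obtain v where v: "v \<in> bdeg_less R J b k m" "x \<otimes> b [^] k \<oplus> v \<in> K (m + k)"
    and p: "x \<in> ideal_pow R J m"
    using prod by (auto simp: lead_ideal_def)
  have carr: "v \<in> carrier R" "x \<in> carrier R" "j \<in> carrier R" "b [^] k \<in> carrier R"
    using b v p prod(1) J bdeg_less_carrier ideal_pow_carrier[OF J] by (auto dest: ideal.Icarr)
  have "(j \<otimes> x) \<otimes> b [^] k \<oplus> j \<otimes> v = j \<otimes> (x \<otimes> b [^] k \<oplus> v)"
    using carr by algebra
  moreover have "j \<in> J <+> PIdl b"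
    using prod(1) set_add_left[OF J cgenideal_ideal[OF b]] by auto
  ultimately show ?case
    using v(2) bdeg_less_mult_left[OF prod(1) v(1)]
    by (auto intro!: bexI[of _ "j \<otimes> v"] ideal_prod.prod)
next
  case (sum x y)
  obtain v w where v: "v \<in> bdeg_less R J b k (Suc m)" "x \<otimes> b [^] k \<oplus> v \<in> (J <+> PIdl b) \<cdot> K (m + k)"
      and w: "w \<in> bdeg_less R J b k (Suc m)" "y \<otimes> b [^] k \<oplus> w \<in> (J <+> PIdl b) \<cdot> K (m + k)"
    using sum.IH by blast
  have "ideal (lead_ideal R J b K k m) R"
    by (intro lead_ideal_ideal K)
  then have "J \<cdot> lead_ideal R J b K k m \<subseteq> carrier R"
    by (rule ideal_prod_in_carrier[OF J])
  then have carr: "v \<in> carrier R" "w \<in> carrier R" "x \<in> carrier R" "y \<in> carrier R" "b [^] k \<in> carrier R"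
    using b v w sum.hyps bdeg_less_carrier by auto
  have "(x \<oplus> y) \<otimes> b [^] k \<oplus> (v \<oplus> w) = (x \<otimes> b [^] k \<oplus> v) \<oplus> (y \<otimes> b [^] k \<oplus> w)"
    using carr by algebra
  then have "(x \<oplus> y) \<otimes> b [^] k \<oplus> (v \<oplus> w) \<in> (J <+> PIdl b) \<cdot> K (m + k)"
    using ideal_prod.sum[OF v(2) w(2)] by simp
  then show ?case
    using v(1) w(1) ideal_add[OF bdeg_less_ideal] by blast
qed

end

end

section \<open>Artin-Rees by descent on the \<open>b\<close>-degree\<close>

context noetherian_cring
begin

lemma ideal_incseq_stable:
  assumes "\<And>n. ideal (I n) R" "\<And>n. I n \<subseteq> I (Suc n)"
  shows "\<exists>k. \<forall>n. I n \<subseteq> I k"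
proof -
  have mono: "I m \<subseteq> I n" if "m \<le> n" for m n
    using assms(2) that by (rule lift_Suc_mono_le)
  have "subset.chain {I. ideal I R} (range I)"
    using assms(1) mono by (auto simp: subset_chain_def) (meson nat_le_linear subsetD)
  then have "\<Union> (range I) \<in> range I"
    by (intro ideal_chain_is_trivial) auto
  then show ?thesis by auto
qed

text \<open>Induction on the number of generators in the manner of Hilbert's basis theorem, without
  forming the Rees algebra. The family \<open>K\<close> is arbitrary, and not just
  \<open>J^n \<inter> I\<close>, because the induction hypothesis is applied to families of leading
  coefficient ideals.\<close>

lemma artin_rees_family:
  assumes "finite A" "A \<subseteq> carrier R"
    and "\<And>n. ideal (K n) R"
    and "\<And>n. K n \<subseteq> ideal_pow R (Idl A) n"
    and "\<And>n. (Idl A) \<cdot> K n \<subseteq> K (Suc n)"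
  shows "\<exists>c. \<forall>n\<ge>c. K (Suc n) \<subseteq> (Idl A) \<cdot> K n"
  using assms
proof (induction A arbitrary: K rule: finite_induct)
  case empty
  have "K (Suc n) \<subseteq> (Idl {}) \<cdot> K n" for n
  proof -
    have "ideal_pow R {\<zero>} (Suc n) \<subseteq> {\<zero>}"
      unfolding ideal_pow_Suc'[OF zeroideal] using ideal.Icarr[OF ideal_pow_ideal[OF zeroideal]]
      by (intro ideal_prod_least zeroideal) auto
    then have "K (Suc n) \<subseteq> {\<zero>}"
      using empty(3)[of "Suc n"] by (auto simp: genideal_empty)
    then show ?thesis
      using ideal_zero[OF ideal_prod_is_ideal[OF genideal_ideal[of "{}"] empty(2)[of n]]] by auto
  qed
  then show ?case by blast
next
  case (insert b A)
  define J where "J = Idl A"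
  have b: "b \<in> carrier R" and Ac: "A \<subseteq> carrier R" using insert.prems by auto
  have J: "ideal J R" unfolding J_def using Ac by (rule genideal_ideal)
  have JJ: "Idl (insert b A) = J <+> PIdl b"
    unfolding J_def using Ac b by (rule genideal_insert)
  note K = insert.prems(2)
  note Kpow = insert.prems(3)[unfolded JJ] and mult = insert.prems(4)[unfolded JJ]
  define L where "L = lead_ideal R J b K"
  have Lid: "ideal (L k m) R" for k m
    unfolding L_def by (rule lead_ideal_ideal[OF J b K])
  have Lmult: "J \<cdot> L k m \<subseteq> L k (Suc m)" and LSuc: "L k m \<subseteq> L (Suc k) m" for k m
    unfolding L_def by (intro lead_ideal_mult[OF J b] K mult)+
  have Lmono: "L k m \<subseteq> L k' m" if "k \<le> k'" for k k' m
    using LSuc that by (rule lift_Suc_mono_le)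
  have lift: "\<exists>w\<in>bdeg_less R J b k (Suc m). d \<otimes> b [^] k \<oplus> w \<in> (J <+> PIdl b) \<cdot> K (m + k)"
    if "d \<in> J \<cdot> L k m" for d k m
    using that unfolding L_def by (intro lead_ideal_prod_lift[OF J b] K)
  have Lpow: "L k m \<subseteq> ideal_pow R J m" for k m
    by (auto simp: L_def lead_ideal_def)
  have stable: "\<exists>c. \<forall>m\<ge>c. M (Suc m) \<subseteq> J \<cdot> M m"
    if "\<And>m. ideal (M m) R" "\<And>m. M m \<subseteq> ideal_pow R J m" "\<And>m. J \<cdot> M m \<subseteq> M (Suc m)" for M
    using insert.IH[OF Ac, of M] that unfolding J_def by blast
  have "\<forall>m. \<exists>k. \<forall>n. L n m \<subseteq> L k m"
    using ideal_incseq_stable[of "\<lambda>n. L n m" for m] Lid LSuc by auto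
  \<comment> \<open>For fixed \<open>m\<close> the chain becomes stationary, so
    \<open>L (s m) m\<close> is the union of the column. The unions form a family in
    \<open>m\<close> to which the induction hypothesis applies.\<close>
  then obtain s where s: "\<And>n m. L n m \<subseteq> L (s m) m" by metis
  obtain cU where cU: "\<And>m. m \<ge> cU \<Longrightarrow> L (s (Suc m)) (Suc m) \<subseteq> J \<cdot> L (s m) m"
  proof -
    have "J \<cdot> L (s m) m \<subseteq> L (s (Suc m)) (Suc m)" for m
      using Lmult[of "s m" m] s[of "s m" "Suc m"] by auto
    then show ?thesis
      using stable[of "\<lambda>m. L (s m) m"] Lid Lpow that by blast
  qed
  \<comment> \<open>Beyond \<open>cU\<close> the union is generated from the previous degree, so
    stationarity at \<open>k0\<close> propagates; below \<open>cU\<close> there are only finitely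
    many columns. Hence one \<open>k0\<close> serves every \<open>m\<close>.\<close>
  define k0 where "k0 = Max (s ` {..cU})"
  have k0: "L k m \<subseteq> L k0 m" for k m
  proof (induction m arbitrary: k)
    case 0
    have "s 0 \<le> k0" unfolding k0_def by (intro Max_ge) auto
    then show ?case using s[of k 0] Lmono[of "s 0" k0 0] by auto
  next
    case (Suc m)
    show ?case
    proof (cases "Suc m \<le> cU")
      case True
      then have "s (Suc m) \<le> k0" unfolding k0_def by (intro Max_ge) auto
      then show ?thesis using s[of k "Suc m"] Lmono[of "s (Suc m)" k0 "Suc m"] by auto
    next
      case False
      then have "L k (Suc m) \<subseteq> J \<cdot> L (s m) m"
        using s[of k "Suc m"] cU[of m] by auto
      also have "\<dots> \<subseteq> J \<cdot> L k0 m"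
        using Suc.IH by (intro ideal_prod_mono) auto
      also have "\<dots> \<subseteq> L k0 (Suc m)" by (rule Lmult)
      finally show ?thesis .
    qed
  qed
  have "\<forall>k. \<exists>c. \<forall>m\<ge>c. L k (Suc m) \<subseteq> J \<cdot> L k m"
    using stable[of "L k" for k] Lid Lpow Lmult by blast
  then obtain c where c: "\<And>k m. m \<ge> c k \<Longrightarrow> L k (Suc m) \<subseteq> J \<cdot> L k m" by metis
  \<comment> \<open>Only the rows \<open>k \<le> k0\<close> need an Artin-Rees bound. For
    \<open>n \<ge> N\<close> and such a \<open>k \<ge> 1\<close>, the coefficient degree
    \<open>m = n + 1 - k\<close> exceeds \<open>c k\<close>.\<close>
  define N where "N = k0 + Max (c ` {..k0})"
  have cN: "c k \<le> N - k0" if "k \<le> k0" for k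
    unfolding N_def using that by auto
  have "K (Suc n) \<subseteq> (J <+> PIdl b) \<cdot> K n" if n: "n \<ge> N" for n
  proof
    let ?JK = "(J <+> PIdl b) \<cdot> K n"
    have JKid: "ideal ?JK R"
      using J b by (intro ideal_prod_is_ideal add_ideals cgenideal_ideal K)
    have JKsub: "?JK \<subseteq> K (Suc n)" by (rule mult)
    \<comment> \<open>The leading term is cancelled by an element of \<open>(J + (b)) K n\<close>,
      which lowers the \<open>b\<close>-degree \<open>k\<close> and keeps the total degree
      \<open>m + k\<close>.\<close>
    have reduce: "x \<in> ?JK"
      if "x \<in> K (Suc n)" "x = d \<otimes> b [^] k \<oplus> v" "d \<in> ideal_pow R J m" "v \<in> bdeg_less R J b k m"
        "m + k = Suc n"
      for x d v k m
      using that
    proof (induction k arbitrary: x d v m)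
      case (0 x d v m)
      have v: "v = \<zero>" and m: "m = Suc n" using 0 by auto
      have "d \<in> carrier R" using 0(3) ideal_pow_carrier[OF J] by (auto dest: ideal.Icarr)
      then have x: "x = d" using 0(2) v by simp
      have "d \<in> L 0 (Suc n)"
        unfolding L_def lead_ideal_def using 0 x m v \<open>d \<in> carrier R\<close> by auto
      moreover have "c 0 \<le> n" using cN[of 0] n by auto
      ultimately have "d \<in> J \<cdot> L 0 n" using c[of 0 n] by auto
      then obtain w where "w \<in> bdeg_less R J b 0 (Suc n)"
        "d \<otimes> b [^] (0::nat) \<oplus> w \<in> (J <+> PIdl b) \<cdot> K (n + 0)"
        using lift by blast
      then show ?case using x \<open>d \<in> carrier R\<close> by auto
    next
      case (Suc k x d v m)
      have dL: "d \<in> L (Suc k) m"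
        unfolding L_def lead_ideal_def using Suc.prems by (auto simp del: bdeg_less.simps nat_pow_Suc)
      have "\<exists>w\<in>bdeg_less R J b (Suc k) m. d \<otimes> b [^] (Suc k) \<oplus> w \<in> ?JK"
      proof (cases "Suc k \<le> k0")
        case True
        moreover have "k0 \<le> N" unfolding N_def by simp
        ultimately have "m \<ge> Suc (c (Suc k))"
          using cN[OF True] n Suc.prems(5) True by arith
        then obtain m' where m': "m = Suc m'" "m' \<ge> c (Suc k)" by (cases m) auto
        then have "d \<in> J \<cdot> L (Suc k) m'" using c[of "Suc k" m'] dL by auto
        moreover have "m' + Suc k = n" using m' Suc.prems(5) by simp
        ultimately show ?thesis
          unfolding m' using lift[of d "Suc k" m'] by simp
      next
        \<comment> \<open>Past \<open>k0\<close> the coefficient already occurs one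
          \<open>b\<close>-degree lower, so a member of \<open>K n\<close> multiplied by
          \<open>b\<close> has the required leading term.\<close>
        case False
        then have "d \<in> L k m" using dL k0[of "Suc k" m] Lmono[of k0 k m] by auto
        then obtain w where w: "w \<in> bdeg_less R J b k m" "d \<otimes> b [^] k \<oplus> w \<in> K (m + k)"
          by (auto simp: L_def lead_ideal_def)
        have carr: "w \<in> carrier R" "d \<in> carrier R" "b [^] k \<in> carrier R"
          using w Suc.prems(3) b bdeg_less_carrier[OF J b] ideal_pow_carrier[OF J]
            by (auto dest: ideal.Icarr)
        have "d \<otimes> b [^] (Suc k) \<oplus> b \<otimes> w = b \<otimes> (d \<otimes> b [^] k \<oplus> w)"
          unfolding nat_pow_Suc using carr b by algebra
        moreover have "b \<in> J <+> PIdl b"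
          using set_add_right[OF J cgenideal_ideal[OF b]] cgenideal_self[OF b] by auto
        moreover have "m + k = n" using Suc.prems(5) by simp
        ultimately show ?thesis
          using w bdeg_less_mult_b[OF J b w(1)]
          by (auto simp del: bdeg_less.simps nat_pow_Suc intro!: bexI[of _ "b \<otimes> w"] ideal_prod.prod)
      qed
      then obtain w where w: "w \<in> bdeg_less R J b (Suc k) m" "d \<otimes> b [^] (Suc k) \<oplus> w \<in> ?JK" by blast
      let ?y = "d \<otimes> b [^] (Suc k) \<oplus> w"
      have carr: "w \<in> carrier R" "d \<in> carrier R" "b [^] Suc k \<in> carrier R" "v \<in> carrier R"
        using w Suc.prems(3,4) b bdeg_less_carrier[OF J b] ideal_pow_carrier[OF J]
        by (auto simp del: bdeg_less.simps)
      have diff: "x \<ominus> ?y = v \<ominus> w"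
        unfolding Suc.prems(2) using carr by algebra
      have "v \<ominus> w \<in> bdeg_less R J b (Suc k) m"
        using ideal_diff[OF bdeg_less_ideal[OF J b]] w Suc.prems(4) by blast
      then obtain v' d' where v': "v' \<in> bdeg_less R J b k (Suc m)" and d': "d' \<in> ideal_pow R J (Suc m)"
        and e: "v \<ominus> w = v' \<oplus> d' \<otimes> b [^] k"
        by (auto elim!: set_addE)
      have carr': "v' \<in> carrier R" "d' \<in> carrier R" "b [^] k \<in> carrier R"
        using v' d' b bdeg_less_carrier[OF J b] ideal_pow_carrier[OF J] by (auto dest: ideal.Icarr)
      have "x \<ominus> ?y \<in> ?JK"
      proof (rule Suc.IH[OF _ _ d' v'])
        show "x \<ominus> ?y \<in> K (Suc n)"
          using ideal_diff[OF K] Suc.prems(1) w(2) JKsub by blast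
        show "x \<ominus> ?y = d' \<otimes> b [^] k \<oplus> v'"
          unfolding diff e using carr' by algebra
      qed (use Suc.prems(5) in simp)
      then have "(x \<ominus> ?y) \<oplus> ?y \<in> ?JK" using w(2) by (rule ideal_add[OF JKid])
      moreover have "(x \<ominus> ?y) \<oplus> ?y = x"
        unfolding Suc.prems(2) using carr by algebra
      ultimately show ?case by simp
    qed
    fix x assume x: "x \<in> K (Suc n)"
    then have "x \<in> bdeg_less R J b (Suc n) 0 <+> PIdl (b [^] Suc n)"
      using Kpow ideal_pow_subset_bdeg[OF J b] by blast
    then obtain v d where v: "v \<in> bdeg_less R J b (Suc n) 0" and d: "d \<in> carrier R"
      and xe: "x = v \<oplus> d \<otimes> b [^] Suc n"
      by (auto elim!: set_addE simp: cgenideal_iff simp del: bdeg_less.simps nat_pow_Suc)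
    have "v \<in> carrier R" using v bdeg_less_carrier[OF J b]
      by (auto dest: ideal.Icarr simp del: bdeg_less.simps)
    then have "x = d \<otimes> b [^] Suc n \<oplus> v"
      unfolding xe using d b by (simp add: a_comm del: nat_pow_Suc)
    then show "x \<in> ?JK"
      using reduce[OF x _ _ v] d by (simp del: bdeg_less.simps nat_pow_Suc)
  qed
  then show ?case unfolding JJ by blast
qed

lemma artin_rees_exists:
  assumes J: "ideal J R" and I: "ideal I R"
  shows "\<exists>c. \<forall>n\<ge>c. ideal_pow R J (n + 1) \<inter> I = J \<cdot> (ideal_pow R J n \<inter> I)"
proof -
  obtain A where A: "A \<subseteq> carrier R" "finite A" "J = Idl A"
    using finetely_gen[OF J] by auto
  let ?K = "\<lambda>n. ideal_pow R J n \<inter> I"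
  have K: "ideal (?K n) R" for n
    by (intro i_intersect ideal_pow_ideal J I)
  have mult: "J \<cdot> ?K n \<subseteq> ?K (Suc n)" for n
    using ideal_pow_Suc'[OF J, of n] ideal.Icarr[OF J] ideal.I_l_closed[OF I]
    by (intro ideal_prod_least K) (auto intro: ideal_prod.prod)
  obtain c where "\<forall>n\<ge>c. ?K (Suc n) \<subseteq> J \<cdot> ?K n"
    using artin_rees_family[OF A(2,1), of ?K, folded A(3), OF K _ mult] by blast
  then show ?thesis
    using mult by (intro exI[of _ c] allI impI equalityI) auto
qed

end

subsection \<open>Krull's intersection theorem\<close>

text \<open>In a Noetherian ring the union of a nonempty chain of ideals belongs to the chain, so it
  inherits properness and Zorn's lemma applies.\<close>

lemma (in noetherian_ring) exists_maximalideal_superset: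
  assumes "ideal I R" "I \<noteq> carrier R"
  shows "\<exists>M. maximalideal M R \<and> I \<subseteq> M"
proof -
  define A where "A = {K. ideal K R \<and> I \<subseteq> K \<and> K \<noteq> carrier R}"
  have "\<exists>M\<in>A. \<forall>Y\<in>A. M \<subseteq> Y \<longrightarrow> Y = M"
  proof (rule subset_Zorn_nonempty)
    fix C assume C: "C \<noteq> {}" "subset.chain A C"
    then have "subset.chain {K. ideal K R} C"
      by (auto simp: subset_chain_def A_def)
    with C show "\<Union> C \<in> A"
      using ideal_chain_is_trivial[OF C(1)] by (auto simp: subset_chain_def)
  qed (use assms in \<open>auto simp: A_def\<close>)
  then obtain M where "M \<in> A" and max: "\<And>Y. Y \<in> A \<Longrightarrow> M \<subseteq> Y \<Longrightarrow> Y = M"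
    by blast
  then have M: "ideal M R" "I \<subseteq> M" "M \<noteq> carrier R"
    by (auto simp: A_def)
  then have "maximalideal M R"
    using max unfolding A_def by (intro maximalidealI) blast+
  with M(2) show ?thesis by blast
qed

context cring
begin

text \<open>Membership in \<open>K + (f)\<close> becomes a congruence modulo \<open>K\<close> with
  an explicit coefficient, so that statements about colon ideals reduce to polynomial identities in
  \<open>R\<close>.\<close>

lemma adjoin_iff:
  assumes "ideal K R" "f \<in> carrier R" "x \<in> carrier R"
  shows "x \<in> K <+> PIdl f \<longleftrightarrow> (\<exists>c\<in>carrier R. x \<ominus> c \<otimes> f \<in> K)"
proof
  assume "x \<in> K <+> PIdl f"
  then obtain k c where kc: "k \<in> K" "c \<in> carrier R" "x = k \<oplus> c \<otimes> f"
    by (auto elim!: set_addE simp: cgenideal_iff)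
  have "k \<in> carrier R" using kc assms by (auto dest: ideal.Icarr)
  then have "x \<ominus> c \<otimes> f = k"
    unfolding kc(3) using kc(2) assms(2) by algebra
  then show "\<exists>c\<in>carrier R. x \<ominus> c \<otimes> f \<in> K" using kc(1,2) by (intro bexI[of _ c]) simp_all
next
  assume "\<exists>c\<in>carrier R. x \<ominus> c \<otimes> f \<in> K"
  then obtain c where c: "c \<in> carrier R" "x \<ominus> c \<otimes> f \<in> K" by blast
  have "x = (x \<ominus> c \<otimes> f) \<oplus> c \<otimes> f" using c(1) assms(2,3) by algebra
  then show "x \<in> K <+> PIdl f"
    using c set_addI[of "x \<ominus> c \<otimes> f" K "c \<otimes> f" "PIdl f"] by (auto simp: cgenideal_iff)
qed

lemma colon_iff: "y \<in> colon R K x \<longleftrightarrow> y \<in> carrier R \<and> y \<otimes> x \<in> K"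
  by (auto simp: colon_def)

text \<open>Since \<open>C : x\<close> is an ideal, a multiplier from a product of ideals may be
  assumed to be a single product instead of a sum of products.\<close>

lemma ideal_prod_mem_colonI:
  assumes "ideal C R" "x \<in> carrier R"
    and "\<And>a b. a \<in> A \<Longrightarrow> b \<in> B \<Longrightarrow> (a \<otimes> b) \<otimes> x \<in> C"
    and "A \<subseteq> carrier R" "B \<subseteq> carrier R" "w \<in> A \<cdot> B"
  shows "w \<otimes> x \<in> C"
proof -
  have "A \<cdot> B \<subseteq> colon R C x"
    using assms(3-5) by (intro ideal_prod_least colon_ideal assms(1,2)) (auto simp: colon_iff)
  then show ?thesis using assms(6) by (auto simp: colon_iff)
qed

end

locale noetherian_local_ring_ideal = noetherian_local_ring +
  fixes J
  assumes J: "ideal J R" and J_proper: "J \<noteq> carrier R"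
begin

abbreviation Jpow :: "nat \<Rightarrow> 'a set" where "Jpow n \<equiv> ideal_pow R J n"

lemmas Jpow_ideal = ideal_pow_ideal[OF J]
lemmas Jpow_carrier = ideal_pow_carrier[OF J]

text \<open>As \<open>J\<close> is proper it lies in the only maximal ideal, which therefore cannot
  contain \<open>1 - j\<close>.\<close>

lemma one_minus_Units:
  assumes "j \<in> J"
  shows "\<one> \<ominus> j \<in> Units R"
proof -
  have j: "j \<in> carrier R" using assms J by (auto dest: ideal.Icarr)
  have P: "ideal (PIdl (\<one> \<ominus> j)) R" using j by (intro cgenideal_ideal) auto
  have "PIdl (\<one> \<ominus> j) = carrier R"
  proof (rule ccontr)
    assume "PIdl (\<one> \<ominus> j) \<noteq> carrier R"
    then obtain M where M: "maximalideal M R" "PIdl (\<one> \<ominus> j) \<subseteq> M"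
      using exists_maximalideal_superset[OF P] by blast
    moreover obtain M' where M': "maximalideal M' R" "J \<subseteq> M'"
      using exists_maximalideal_superset[OF J J_proper] by blast
    ultimately have "\<one> \<ominus> j \<in> \<mm>" "j \<in> \<mm>"
      using unique_maximal[OF M(1)] unique_maximal[OF M'(1)] assms cgenideal_self[of "\<one> \<ominus> j"] j
      by auto
    moreover have "ideal \<mm> R" using maximal by (simp add: maximalideal_def)
    ultimately have "(\<one> \<ominus> j) \<oplus> j \<in> \<mm>" by (intro ideal_add)
    moreover have "(\<one> \<ominus> j) \<oplus> j = \<one>" using j by algebra
    ultimately have "\<mm> = carrier R"
      using ideal.one_imp_carrier[OF \<open>ideal \<mm> R\<close>] by simp
    then show False
      using maximalideal.I_notcarr[OF maximal] by simp
  qed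
  then obtain c where "c \<in> carrier R" "\<one> = c \<otimes> (\<one> \<ominus> j)"
    using cgenideal_iff[of \<one> "\<one> \<ominus> j"] by auto
  then show ?thesis
    using j by (auto simp: Units_def m_comm intro!: bexI[of _ c])
qed

text \<open>Generators of \<open>D\<close> modulo \<open>T\<close> are discarded one at a time. If
  \<open>D\<close> lies in \<open>S + (d)\<close>, where \<open>S\<close> is \<open>T\<close> plus
  the remaining generators, then \<open>J D\<close> lies in \<open>S + J d\<close>; hence
  \<open>(1 - j) d\<close> lies in \<open>S\<close> for some \<open>j \<in> J\<close>, and
  \<open>1 - j\<close> is a unit.\<close>

lemma nakayama:
  assumes D: "ideal D R" and T: "ideal T R" and sub: "D \<subseteq> T <+> J \<cdot> D"
  shows "D \<subseteq> T"
proof -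
  obtain A where A: "A \<subseteq> carrier R" "finite A" "D = Idl A"
    using finetely_gen[OF D] by auto
  have "D \<subseteq> T" if "finite B" "B \<subseteq> D" "D \<subseteq> T <+> Idl B" for B
    using that
  proof (induction B rule: finite_induct)
    case empty
    have "T <+> {\<zero>} \<subseteq> T"
      using T by (intro set_add_least) (auto simp: ideal_zero)
    with empty show ?case by (auto simp: genideal_empty)
  next
    case (insert d B)
    have Bc: "B \<subseteq> carrier R" and d: "d \<in> D" and dc: "d \<in> carrier R"
      using insert.prems(1) ideal_subset[OF D] by auto
    have IB: "ideal (Idl B) R" using Bc by (rule genideal_ideal)
    define S where "S = T <+> Idl B"
    have S: "ideal S R" unfolding S_def by (intro add_ideals T IB)
    have TS: "T \<subseteq> S" and BS: "Idl B \<subseteq> S"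
      unfolding S_def by (intro set_add_left set_add_right T IB)+
    have DS: "x \<in> S <+> PIdl d" if "x \<in> D" for x
    proof -
      have "D \<subseteq> T <+> (Idl B <+> PIdl d)"
        using insert.prems(2) genideal_insert[OF Bc dc] by simp
      also have "\<dots> \<subseteq> S <+> PIdl d"
        using TS BS set_add_left[OF S cgenideal_ideal[OF dc]]
        by (intro set_add_least set_add_mono add_ideals S cgenideal_ideal dc) auto
      finally show ?thesis using that by auto
    qed
    have Jd: "ideal ((\<lambda>j. j \<otimes> d) ` J) R" using J dc by (rule ideal_image_mult)
    have SJd: "ideal (S <+> (\<lambda>j. j \<otimes> d) ` J) R" using S Jd by (rule add_ideals)
    have "J \<cdot> D \<subseteq> S <+> (\<lambda>j. j \<otimes> d) ` J"
    proof (rule ideal_prod_least[OF SJd])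
      fix j x assume j: "j \<in> J" and x: "x \<in> D"
      obtain v c where v: "v \<in> S" and c: "c \<in> carrier R" and xe: "x = v \<oplus> c \<otimes> d"
        using DS[OF x] by (auto elim!: set_addE simp: cgenideal_iff)
      have jc: "j \<in> carrier R" and vc: "v \<in> carrier R"
        using j J v S by (auto dest: ideal.Icarr)
      have "j \<otimes> x = j \<otimes> v \<oplus> (j \<otimes> c) \<otimes> d"
        unfolding xe using jc vc c dc by algebra
      moreover have "j \<otimes> v \<in> S" "j \<otimes> c \<in> J"
        using ideal.I_l_closed[OF S v jc] ideal.I_r_closed[OF J j c] by auto
      ultimately show "j \<otimes> x \<in> S <+> (\<lambda>j. j \<otimes> d) ` J"
        by (metis imageI set_addI)
    qed
    then have "T <+> J \<cdot> D \<subseteq> S <+> (\<lambda>j. j \<otimes> d) ` J"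
      using TS set_add_left[OF S Jd] by (intro set_add_least[OF SJd]) auto
    then have "d \<in> S <+> (\<lambda>j. j \<otimes> d) ` J" using sub d by blast
    then obtain v w where v: "v \<in> S" and w: "w \<in> (\<lambda>j. j \<otimes> d) ` J" and dw: "d = v \<oplus> w"
      by (rule set_addE)
    obtain j where j: "j \<in> J" and wj: "w = j \<otimes> d" using w by (rule imageE)
    have de: "d = v \<oplus> j \<otimes> d" using dw unfolding wj .
    have jc: "j \<in> carrier R" and vc: "v \<in> carrier R"
      using j J v S by (auto dest: ideal.Icarr)
    have U: "\<one> \<ominus> j \<in> Units R" using j by (rule one_minus_Units)
    have "(\<one> \<ominus> j) \<otimes> d = d \<ominus> j \<otimes> d" using jc dc by algebra
    also have "\<dots> = (v \<oplus> j \<otimes> d) \<ominus> j \<otimes> d" by (subst de) (rule refl)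
    also have "\<dots> = v" using jc dc vc by algebra
    finally have v': "(\<one> \<ominus> j) \<otimes> d = v" .
    have "inv (\<one> \<ominus> j) \<otimes> ((\<one> \<ominus> j) \<otimes> d) = d"
      using U dc jc by (simp add: m_assoc[symmetric])
    moreover have "inv (\<one> \<ominus> j) \<otimes> v \<in> S"
      using U by (intro ideal.I_l_closed[OF S v]) simp
    ultimately have "d \<in> S" unfolding v' by simp
    then have "PIdl d \<subseteq> S" by (rule cgenideal_minimal[OF S])
    then have "D \<subseteq> S"
      using DS set_add_least[OF S, of S "PIdl d"] by auto
    then show ?case
      using insert.IH insert.prems(1) unfolding S_def by auto
  qed
  moreover have "A \<subseteq> D" "D \<subseteq> T <+> Idl A"
    using genideal_self[OF A(1)] set_add_right[OF T D] A(3) by auto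
  ultimately show ?thesis using A(2) by blast
qed

text \<open>Krull's theorem for \<open>R/T\<close>, carried out in \<open>R\<close>. Artin-Rees for
  the intersection \<open>D\<close> itself puts \<open>J^(c+1) \<inter> D\<close> into
  \<open>J D\<close>, so \<open>D\<close> is contained in \<open>T + J D\<close> and Nakayama's
  lemma applies.\<close>

lemma krull_intersection:
  assumes T: "ideal T R" and x: "\<And>n. x \<in> T <+> Jpow n"
  shows "x \<in> T"
proof -
  define D where "D = (\<Inter>n. T <+> Jpow n)"
  have D: "ideal D R"
    unfolding D_def by (intro i_Intersect) (auto intro!: add_ideals T Jpow_ideal)
  have TD: "T \<subseteq> D"
    unfolding D_def using set_add_left[OF T Jpow_ideal] by auto
  obtain c where c: "Jpow (c + 1) \<inter> D = J \<cdot> (Jpow c \<inter> D)"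
    using artin_rees_exists[OF J D] by blast
  have "D \<subseteq> T <+> J \<cdot> D"
  proof
    fix y assume y: "y \<in> D"
    then have "y \<in> T <+> Jpow (c + 1)" unfolding D_def by blast
    then obtain t z where tz: "t \<in> T" "z \<in> Jpow (c + 1)" "y = t \<oplus> z"
      by (rule set_addE)
    have carr: "t \<in> carrier R" "z \<in> carrier R"
      using tz T Jpow_carrier by (auto dest: ideal.Icarr)
    have "z = y \<ominus> t" unfolding tz(3) using carr by algebra
    then have "z \<in> D" using ideal_diff[OF D y] tz(1) TD by auto
    then have "z \<in> J \<cdot> (Jpow c \<inter> D)"
      using c tz(2) by blast
    also have "\<dots> \<subseteq> J \<cdot> D" by (intro ideal_prod_mono) auto
    finally show "y \<in> T <+> J \<cdot> D" unfolding tz(3) using tz(1) by (intro set_addI)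
  qed
  then have "D \<subseteq> T" by (rule nakayama[OF D T])
  then show ?thesis using x unfolding D_def by blast
qed

end

subsection \<open>Perturbing one element modulo an ideal\<close>

context noetherian_local_ring_ideal
begin

text \<open>The condition whose least solution is the Artin-Rees number. The perturbation steps need
  some solution below \<open>N\<close>, and equality of these predicates gives equality of the least
  solutions.\<close>

definition ar_bound :: "'a set \<Rightarrow> nat \<Rightarrow> bool" where
  "ar_bound I c \<longleftrightarrow> (\<forall>n\<ge>c. Jpow (n + 1) \<inter> I = J \<cdot> (Jpow n \<inter> I))"

lemma ar_bound_artin_rees: "ideal I R \<Longrightarrow> ar_bound I (artin_rees R J I)"
  unfolding ar_bound_def artin_rees_def using artin_rees_exists[OF J] by (rule LeastI_ex)

text \<open>Iterates the Artin-Rees equality downwards from \<open>n\<close> to \<open>c\<close>.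
  For \<open>n < c\<close> the truncated difference is 0 and the zeroth power is the whole
  ring.\<close>

lemma ar_bound_prod:
  assumes I: "ideal I R" and c: "ar_bound I c"
  shows "Jpow n \<inter> I \<subseteq> Jpow (n - c) \<cdot> I"
proof -
  have one: "I \<subseteq> carrier R \<cdot> I"
    using ideal_prod_one[OF I] ideal_prod_commute[OF I oneideal] by simp
  have "Jpow (c + k) \<inter> I \<subseteq> Jpow k \<cdot> I" for k
  proof (induction k)
    case 0
    show ?case using one by auto
  next
    case (Suc k)
    have "Jpow (c + Suc k) \<inter> I = J \<cdot> (Jpow (c + k) \<inter> I)"
      using c by (simp add: ar_bound_def)
    also have "\<dots> \<subseteq> J \<cdot> (Jpow k \<cdot> I)"
      using Suc by (intro ideal_prod_mono) auto
    also have "\<dots> = Jpow (Suc k) \<cdot> I"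
      by (simp add: ideal_pow_Suc'[OF J] ideal_prod_assoc J I Jpow_ideal)
    finally show ?case .
  qed
  from this[of "n - c"] show ?thesis
    using one by (cases "c \<le> n") auto
qed

text \<open>The form in which Artin-Rees enters the perturbation: an element of
  \<open>K + (f)\<close> of order \<open>n\<close> has a coefficient of \<open>f\<close> of order at
  least \<open>n - c\<close>. Multiplied by \<open>e \<in> J^N\<close> with \<open>N > c\<close>,
  this coefficient has order above \<open>n\<close>. It holds because
  \<open>J^(n-c) (K + (f))\<close> is contained in \<open>K + J^(n-c) f\<close>.\<close>

lemma ar_bound_adjoin:
  assumes K: "ideal K R" and f: "f \<in> carrier R" and c: "ar_bound (K <+> PIdl f) c"
    and x: "x \<in> K <+> PIdl f" "x \<in> Jpow n"
  obtains y where "y \<in> Jpow (n - c)" "x \<ominus> y \<otimes> f \<in> K"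
proof -
  let ?E = "K <+> PIdl f" and ?F = "(\<lambda>y. y \<otimes> f) ` Jpow (n - c)"
  have E: "ideal ?E R" using K f by (intro add_ideals cgenideal_ideal)
  have F: "ideal ?F R" by (rule ideal_image_mult[OF Jpow_ideal f])
  have "Jpow (n - c) \<cdot> ?E \<subseteq> K <+> ?F"
  proof (rule ideal_prod_least[OF add_ideals[OF K F]])
    fix w e assume w: "w \<in> Jpow (n - c)" and "e \<in> ?E"
    then obtain k d where k: "k \<in> K" and d: "d \<in> carrier R" and e: "e = k \<oplus> d \<otimes> f"
      by (auto elim!: set_addE simp: cgenideal_iff)
    have carr: "w \<in> carrier R" "k \<in> carrier R"
      using w k K Jpow_carrier by (auto dest: ideal.Icarr)
    have "w \<otimes> e = w \<otimes> k \<oplus> (w \<otimes> d) \<otimes> f"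
      unfolding e using carr d f by algebra
    moreover have "w \<otimes> k \<in> K" "w \<otimes> d \<in> Jpow (n - c)"
      using ideal.I_l_closed[OF K k carr(1)] ideal.I_r_closed[OF Jpow_ideal w d] by auto
    ultimately show "w \<otimes> e \<in> K <+> ?F"
      by (metis imageI set_addI)
  qed
  then have "x \<in> K <+> ?F"
    using ar_bound_prod[OF E c] x by blast
  then obtain k y where k: "k \<in> K" and y: "y \<in> Jpow (n - c)" and xe: "x = k \<oplus> y \<otimes> f"
    by (auto elim!: set_addE)
  have carr: "y \<in> carrier R" "k \<in> carrier R"
    using y k K Jpow_carrier by (auto dest: ideal.Icarr)
  have "x \<ominus> y \<otimes> f = k" unfolding xe using carr f by algebra
  then show ?thesis using that y k by simp
qed

text \<open>Equality of initial ideals degree by degree, with each component replaced by its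
  preimage in \<open>J^n\<close>; this avoids cosets.\<close>

definition same_initial :: "'a set \<Rightarrow> 'a set \<Rightarrow> bool" where
  "same_initial E E' \<longleftrightarrow> (\<forall>n. (E \<inter> Jpow n) <+> Jpow (n + 1) = (E' \<inter> Jpow n) <+> Jpow (n + 1))"

lemma Jpow_prod_mem:
  assumes "Jpow s \<cdot> A \<subseteq> K" "s \<le> n" "x \<in> A" "e \<in> Jpow n"
  shows "e \<otimes> x \<in> K"
  using ideal_prod.prod[of e "Jpow s" x A R] ideal_pow_antimono[OF J assms(2)] assms by blast

section \<open>Stability of the colon ideal and of the initial ideal\<close>

context
  fixes K f e s c N
  assumes K: "ideal K R" and f: "f \<in> carrier R" and e: "e \<in> Jpow N"
    and s: "Jpow s \<cdot> colon R K f \<subseteq> K" and sN: "s < N"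
    and c: "ar_bound (K <+> PIdl f) c" and cN: "c < N"
begin

text \<open>One inclusion holds because \<open>e\<close> multiplies \<open>K : f\<close> into
  \<open>K\<close>. For the other, \<open>x\<close> is approximated by \<open>K : f\<close> modulo
  every \<open>J^n\<close>: if \<open>y\<close> is the error, then \<open>y e\<close> is congruent
  to \<open>- y f\<close> modulo \<open>K\<close>, hence also to \<open>y' f\<close> with
  \<open>y'\<close> of higher order, and \<open>y + y'\<close> lies in \<open>K : f\<close>. So
  \<open>y\<close> may be replaced by \<open>- y'\<close>, and Krull's theorem finishes.\<close>

lemma colon_perturb: "colon R K (f \<oplus> e) = colon R K f"
proof (intro equalityI subsetI)
  have ec: "e \<in> carrier R" using e by (rule Jpow_carrier)
  have colon_e: "z \<otimes> e \<in> K" "z \<otimes> (f \<oplus> e) \<in> K" if "z \<in> colon R K f" for z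
  proof -
    have z: "z \<in> carrier R" "z \<otimes> f \<in> K" using that by (auto simp: colon_iff)
    have "e \<otimes> z \<in> K" using sN by (intro Jpow_prod_mem[OF s _ that e]) simp
    then show ze: "z \<otimes> e \<in> K" using z ec by (simp add: m_comm)
    show "z \<otimes> (f \<oplus> e) \<in> K"
      using ideal_add[OF K z(2) ze] z(1) f ec by (simp add: r_distr)
  qed
  show "x \<in> colon R K (f \<oplus> e)" if "x \<in> colon R K f" for x
    using colon_e(2)[OF that] that by (auto simp: colon_iff)
  show "x \<in> colon R K f" if "x \<in> colon R K (f \<oplus> e)" for x
  proof (rule krull_intersection)
    show C: "ideal (colon R K f) R" using K f by (rule colon_ideal)
    have x: "x \<in> carrier R" "x \<otimes> (f \<oplus> e) \<in> K" using that by (auto simp: colon_iff)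
    show "x \<in> colon R K f <+> Jpow n" for n
    proof (induction n)
      case 0
      show ?case using set_add_right[OF C oneideal] x by auto
    next
      case (Suc n)
      then obtain z y where z: "z \<in> colon R K f" and y: "y \<in> Jpow n" and xe: "x = z \<oplus> y"
        by (rule set_addE)
      have carr: "z \<in> carrier R" "y \<in> carrier R"
        using z y Jpow_carrier by (auto simp: colon_iff)
      have "x \<otimes> (f \<oplus> e) \<ominus> z \<otimes> (f \<oplus> e) \<in> K"
        using ideal_diff[OF K x(2) colon_e(2)[OF z]] .
      moreover have "x \<otimes> (f \<oplus> e) \<ominus> z \<otimes> (f \<oplus> e) = y \<otimes> e \<ominus> (\<ominus> y) \<otimes> f"
        unfolding xe using carr f ec by algebra
      ultimately have yf: "y \<otimes> e \<ominus> (\<ominus> y) \<otimes> f \<in> K" by simp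
      then have "y \<otimes> e \<in> K <+> PIdl f"
        using adjoin_iff[OF K f, of "y \<otimes> e"] carr ec by auto
      moreover have "y \<otimes> e \<in> Jpow (n + N)" using J y e by (rule ideal_pow_mult)
      ultimately obtain y' where y': "y' \<in> Jpow (n + N - c)" "y \<otimes> e \<ominus> y' \<otimes> f \<in> K"
        using ar_bound_adjoin[OF K f c] by blast
      \<comment> \<open>As \<open>c < N\<close>, the exponent \<open>n + N - c\<close> is at least
        \<open>n + 1\<close>.\<close>
      have y'J: "y' \<in> Jpow (Suc n)"
        using y'(1) cN subsetD[OF ideal_pow_antimono[OF J, of "Suc n" "n + N - c"], of y'] by simp
      have y'c: "y' \<in> carrier R" using y'(1) by (rule Jpow_carrier)
      have "(y \<otimes> e \<ominus> y' \<otimes> f) \<ominus> (y \<otimes> e \<ominus> (\<ominus> y) \<otimes> f) \<in> K"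
        using ideal_diff[OF K y'(2) yf] .
      moreover have "(y \<otimes> e \<ominus> y' \<otimes> f) \<ominus> (y \<otimes> e \<ominus> (\<ominus> y) \<otimes> f) = (\<ominus> (y \<oplus> y')) \<otimes> f"
        using carr ec f y'c by algebra
      ultimately have "\<ominus> (y \<oplus> y') \<in> colon R K f"
        using carr y'c by (simp add: colon_iff)
      then have "z \<ominus> (\<ominus> (y \<oplus> y')) \<in> colon R K f"
        by (rule ideal_diff[OF C z])
      moreover have "\<ominus> y' \<in> Jpow (Suc n)" using y'J by (rule ideal_uminus[OF Jpow_ideal])
      moreover have "x = (z \<ominus> (\<ominus> (y \<oplus> y'))) \<oplus> (\<ominus> y')"
        unfolding xe using carr y'c by algebra
      ultimately show ?case by (metis set_addI)
    qed
  qed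
qed

text \<open>An element \<open>x\<close> of order \<open>n\<close> with \<open>f\<close>-coefficient
  \<open>y\<close> is replaced by \<open>x + y e\<close> or \<open>x - y e\<close>, which changes it
  only in order \<open>n + 1\<close> once \<open>y \<in> J^(n-c)\<close>. For \<open>K + (f)\<close>
  the Artin-Rees bound supplies such a \<open>y\<close>; for \<open>K + (f + e)\<close> no bound is
  known yet, and the order of the coefficient has to be raised step by step.\<close>

lemma initial_perturb: "same_initial (K <+> PIdl f) (K <+> PIdl (f \<oplus> e))"
proof -
  let ?f = "f \<oplus> e"
  let ?E = "K <+> PIdl f" and ?E' = "K <+> PIdl ?f"
  have ec: "e \<in> carrier R" using e by (rule Jpow_carrier)
  have fc: "?f \<in> carrier R" using f ec by simp
  have E: "ideal ?E R" and E': "ideal ?E' R" using K f fc by (auto intro: add_ideals cgenideal_ideal)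
  have small: "y \<otimes> e \<in> Jpow (n + 1)" if "y \<in> Jpow (n - c)" for y n
  proof -
    have "n + 1 \<le> n - c + N" using cN by arith
    then show ?thesis
      using ideal_pow_mult[OF J that e] ideal_pow_antimono[OF J, of "n + 1" "n - c + N"] by blast
  qed
  have "x \<in> (?E' \<inter> Jpow n) <+> Jpow (n + 1)" if x: "x \<in> ?E" "x \<in> Jpow n" for x n
  proof -
    obtain y where y: "y \<in> Jpow (n - c)" "x \<ominus> y \<otimes> f \<in> K"
      using ar_bound_adjoin[OF K f c x] by blast
    have carr: "x \<in> carrier R" "y \<in> carrier R" using x y Jpow_carrier by auto
    have ye: "y \<otimes> e \<in> Jpow (n + 1)" using y(1) by (rule small)
    then have "y \<otimes> e \<in> Jpow n" using ideal_pow_antimono[OF J, of n "n + 1"] by auto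
    then have 1: "x \<oplus> y \<otimes> e \<in> Jpow n" using x(2) by (intro ideal_add[OF Jpow_ideal])
    have "(x \<oplus> y \<otimes> e) \<ominus> y \<otimes> ?f = x \<ominus> y \<otimes> f" using carr f ec by algebra
    then have "(x \<oplus> y \<otimes> e) \<ominus> y \<otimes> ?f \<in> K" using y(2) by simp
    then have 2: "x \<oplus> y \<otimes> e \<in> ?E'"
      using adjoin_iff[OF K fc, of "x \<oplus> y \<otimes> e"] carr ec by blast
    have "x = (x \<oplus> y \<otimes> e) \<oplus> (\<ominus> (y \<otimes> e))" using carr ec by algebra
    then show ?thesis
      using 1 2 ideal_uminus[OF Jpow_ideal ye] by (metis IntI set_addI)
  qed
  moreover have "x \<in> (?E \<inter> Jpow n) <+> Jpow (n + 1)" if x: "x \<in> ?E'" "x \<in> Jpow n" for x n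
  proof -
    have xc: "x \<in> carrier R" using x(2) by (rule Jpow_carrier)
    \<comment> \<open>A coefficient \<open>y\<close> at level \<open>m\<close> makes
      \<open>x - y e\<close> an element of \<open>K + (f)\<close> of order \<open>m + 1\<close>,
      which has a coefficient \<open>y'\<close> one level deeper. The difference
      \<open>y - y'\<close> lies in \<open>K : f\<close>, which equals \<open>K : (f + e)\<close>,
      so \<open>y'\<close> is a coefficient of \<open>x\<close> with respect to \<open>f + e\<close>
      as well.\<close>
    have "\<exists>y\<in>Jpow (m - c). x \<ominus> y \<otimes> ?f \<in> K" if "m \<le> n" for m
      using that
    proof (induction m)
      case 0
      show ?case using x(1) adjoin_iff[OF K fc xc] by simp
    next
      case (Suc m)
      then obtain y where y: "y \<in> Jpow (m - c)" "x \<ominus> y \<otimes> ?f \<in> K" by auto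
      have yc: "y \<in> carrier R" using y(1) by (rule Jpow_carrier)
      have "x \<in> Jpow (Suc m)"
        using x(2) Suc.prems ideal_pow_antimono[OF J, of "Suc m" n] by auto
      then have 1: "x \<ominus> y \<otimes> e \<in> Jpow (Suc m)"
        using small[OF y(1)] by (intro ideal_diff[OF Jpow_ideal]) simp_all
      have "(x \<ominus> y \<otimes> e) \<ominus> y \<otimes> f = x \<ominus> y \<otimes> ?f" using xc yc f ec by algebra
      then have K1: "(x \<ominus> y \<otimes> e) \<ominus> y \<otimes> f \<in> K" using y(2) by simp
      then have 2: "x \<ominus> y \<otimes> e \<in> ?E"
        using adjoin_iff[OF K f, of "x \<ominus> y \<otimes> e"] yc xc ec by auto
      obtain y' where y': "y' \<in> Jpow (Suc m - c)" "(x \<ominus> y \<otimes> e) \<ominus> y' \<otimes> f \<in> K"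
        using ar_bound_adjoin[OF K f c 2 1] by blast
      have y'c: "y' \<in> carrier R" using y'(1) by (rule Jpow_carrier)
      have "((x \<ominus> y \<otimes> e) \<ominus> y' \<otimes> f) \<ominus> ((x \<ominus> y \<otimes> e) \<ominus> y \<otimes> f) = (y \<ominus> y') \<otimes> f"
        using xc yc y'c f ec by algebra
      then have "y \<ominus> y' \<in> colon R K f"
        using ideal_diff[OF K y'(2) K1] yc y'c by (simp add: colon_iff)
      then have "(y \<ominus> y') \<otimes> ?f \<in> K"
        using colon_perturb by (auto simp: colon_iff)
      then have "(x \<ominus> y \<otimes> ?f) \<oplus> (y \<ominus> y') \<otimes> ?f \<in> K"
        using y(2) by (intro ideal_add[OF K])
      moreover have "(x \<ominus> y \<otimes> ?f) \<oplus> (y \<ominus> y') \<otimes> ?f = x \<ominus> y' \<otimes> ?f"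
        using xc yc y'c fc by algebra
      ultimately show ?case using y'(1) by auto
    qed
    then obtain y where y: "y \<in> Jpow (n - c)" "x \<ominus> y \<otimes> ?f \<in> K" by blast
    have yc: "y \<in> carrier R" using y(1) by (rule Jpow_carrier)
    have ye: "y \<otimes> e \<in> Jpow (n + 1)" using y(1) by (rule small)
    then have "y \<otimes> e \<in> Jpow n" using ideal_pow_antimono[OF J, of n "n + 1"] by auto
    then have 1: "x \<ominus> y \<otimes> e \<in> Jpow n" using x(2) by (intro ideal_diff[OF Jpow_ideal])
    have "(x \<ominus> y \<otimes> e) \<ominus> y \<otimes> f = x \<ominus> y \<otimes> ?f" using xc yc f ec by algebra
    then have "(x \<ominus> y \<otimes> e) \<ominus> y \<otimes> f \<in> K" using y(2) by simp
    then have 2: "x \<ominus> y \<otimes> e \<in> ?E"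
      using adjoin_iff[OF K f, of "x \<ominus> y \<otimes> e"] xc yc ec by blast
    have "x = (x \<ominus> y \<otimes> e) \<oplus> y \<otimes> e" using xc yc ec by algebra
    then show ?thesis using 1 2 ye by (metis IntI set_addI)
  qed
  ultimately have "?E \<inter> Jpow n \<subseteq> (?E' \<inter> Jpow n) <+> Jpow (n + 1)"
    "?E' \<inter> Jpow n \<subseteq> (?E \<inter> Jpow n) <+> Jpow (n + 1)" for n by auto
  moreover have "ideal ((A \<inter> Jpow n) <+> Jpow (n + 1)) R"
    "Jpow (n + 1) \<subseteq> (A \<inter> Jpow n) <+> Jpow (n + 1)" if "ideal A R" for A n
    by (rule add_ideals set_add_right, rule i_intersect, rule that, rule Jpow_ideal, rule Jpow_ideal)+
  ultimately show ?thesis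
    unfolding same_initial_def using E E' by (intro allI equalityI set_add_least) auto
qed

end

text \<open>
  The exponents add because \<open>J\<^sup>s\<close> and \<open>J\<^sup>a\<close> kill the two outer terms of the exact sequence for the
  first Koszul homology of \<open>f, g\<close> on \<open>R/K\<close>, which is symmetric in \<open>f\<close> and \<open>g\<close>.
\<close>

lemma colon_swap:
  assumes K: "ideal K R" and f: "f \<in> carrier R" and g: "g \<in> carrier R"
    and s: "Jpow s \<cdot> colon R K f \<subseteq> K"
    and a: "Jpow a \<cdot> colon R (K <+> PIdl f) g \<subseteq> K <+> PIdl f"
  shows "Jpow (s + a) \<cdot> colon R (K <+> PIdl g) f \<subseteq> K <+> PIdl g"
proof -
  have Kf: "ideal (K <+> PIdl f) R" and Kg: "ideal (K <+> PIdl g) R"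
    using K f g by (auto intro: add_ideals cgenideal_ideal)
  have "w \<otimes> x \<in> K <+> PIdl g" if w: "w \<in> Jpow s \<cdot> Jpow a" and x: "x \<in> colon R (K <+> PIdl g) f" for w x
  proof -
    have xc: "x \<in> carrier R" and xf: "x \<otimes> f \<in> K <+> PIdl g" using x by (auto simp: colon_iff)
    obtain z where z: "z \<in> carrier R" "x \<otimes> f \<ominus> z \<otimes> g \<in> K"
      using xf adjoin_iff[OF K g, of "x \<otimes> f"] xc f by auto
    have "z \<otimes> g \<ominus> x \<otimes> f = \<ominus> (x \<otimes> f \<ominus> z \<otimes> g)" using xc z f g by algebra
    then have "z \<otimes> g \<ominus> x \<otimes> f \<in> K" using ideal_uminus[OF K z(2)] by simp
    then have zg: "z \<in> colon R (K <+> PIdl f) g"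
      using z(1) xc g adjoin_iff[OF K f, of "z \<otimes> g"] by (auto simp: colon_iff)
    show ?thesis
    proof (rule ideal_prod_mem_colonI[OF Kg xc _ _ _ w])
      fix q p assume q: "q \<in> Jpow s" and p: "p \<in> Jpow a"
      have qc: "q \<in> carrier R" and pc: "p \<in> carrier R" using p q Jpow_carrier by auto
      have "p \<otimes> z \<in> K <+> PIdl f" using a ideal_prod.prod[OF p zg, of R] by blast
      then obtain v where v: "v \<in> carrier R" "p \<otimes> z \<ominus> v \<otimes> f \<in> K"
        using adjoin_iff[OF K f, of "p \<otimes> z"] pc z(1) by auto
      \<comment> \<open>Modulo \<open>K\<close> one has \<open>p x f = p z g = v f g\<close>, so
        \<open>p x - v g\<close> lies in \<open>K : f\<close>.\<close>
      have "p \<otimes> (x \<otimes> f \<ominus> z \<otimes> g) \<oplus> g \<otimes> (p \<otimes> z \<ominus> v \<otimes> f) \<in> K"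
        using ideal.I_l_closed[OF K z(2) pc] ideal.I_l_closed[OF K v(2) g] by (rule ideal_add[OF K])
      moreover have "p \<otimes> (x \<otimes> f \<ominus> z \<otimes> g) \<oplus> g \<otimes> (p \<otimes> z \<ominus> v \<otimes> f) = (p \<otimes> x \<ominus> v \<otimes> g) \<otimes> f"
        using xc z(1) pc v(1) f g by algebra
      ultimately have "p \<otimes> x \<ominus> v \<otimes> g \<in> colon R K f"
        using xc pc v(1) g by (simp add: colon_iff)
      then have "q \<otimes> (p \<otimes> x \<ominus> v \<otimes> g) \<in> K" using s ideal_prod.prod[OF q, of _ _ R] by blast
      moreover have "q \<otimes> (p \<otimes> x \<ominus> v \<otimes> g) = (q \<otimes> p) \<otimes> x \<ominus> (q \<otimes> v) \<otimes> g"
        using xc pc qc v(1) g by algebra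
      ultimately show "(q \<otimes> p) \<otimes> x \<in> K <+> PIdl g"
        using adjoin_iff[OF K g, of "(q \<otimes> p) \<otimes> x"] xc pc qc v(1) by auto
    qed (use Jpow_ideal in \<open>auto dest: ideal_subset\<close>)
  qed
  then show ?thesis
    unfolding ideal_pow_add[OF J] by (intro ideal_prod_least Kg)
qed

text \<open>
  Passing from \<open>f\<close> to \<open>f + e\<close>, the element \<open>z\<close> of \<open>(K + (f)) : g\<close> is corrected to the element \<open>z + t\<close> of
  \<open>(K + (f + e)) : g\<close>: for \<open>e = p q\<close> and \<open>p z = v f\<close> modulo \<open>K\<close> one takes \<open>t = q v\<close>.
\<close>

lemma colon_correction:
  assumes K: "ideal K R" and f: "f \<in> carrier R" and g: "g \<in> carrier R"
    and s: "Jpow s \<cdot> colon R K f \<subseteq> K"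
    and a: "Jpow a \<cdot> colon R (K <+> PIdl f) g \<subseteq> K <+> PIdl f"
    and z: "z \<in> colon R (K <+> PIdl f) g"
    and e: "e \<in> Jpow a \<cdot> Jpow (Suc s)"
  shows "\<exists>t\<in>carrier R.
    (\<forall>w\<in>carrier R. \<forall>u\<in>carrier R. w \<otimes> z \<ominus> u \<otimes> f \<in> K \<longrightarrow> w \<otimes> t \<ominus> u \<otimes> e \<in> K)
    \<and> (z \<in> colon R K g \<longrightarrow> t \<in> J \<cdot> colon R K g)"
  using e
proof induction
  case (prod p q)
  have zc: "z \<in> carrier R" using z by (auto simp: colon_iff)
  have pc: "p \<in> carrier R" and qc: "q \<in> carrier R" using prod Jpow_carrier by auto
  have "p \<otimes> z \<in> K <+> PIdl f" using a ideal_prod.prod[OF prod(1) z, of R] by blast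
  then obtain v where v: "v \<in> carrier R" "p \<otimes> z \<ominus> v \<otimes> f \<in> K"
    using adjoin_iff[OF K f, of "p \<otimes> z"] pc zc by auto
  have Jq: "q \<in> Jpow s" using prod(2) ideal_pow_antimono[OF J, of s "Suc s"] by auto
  have "w \<otimes> (q \<otimes> v) \<ominus> u \<otimes> (p \<otimes> q) \<in> K"
    if w: "w \<in> carrier R" and u: "u \<in> carrier R" and wz: "w \<otimes> z \<ominus> u \<otimes> f \<in> K" for w u
  proof -
    \<comment> \<open>Both \<open>p u f\<close> and \<open>w v f\<close> are congruent to
      \<open>p w z\<close> modulo \<open>K\<close>. The coefficients thus differ by an element of
      \<open>K : f\<close>, which \<open>q \<in> J^s\<close> multiplies into
      \<open>K\<close>.\<close>
    have "w \<otimes> (p \<otimes> z \<ominus> v \<otimes> f) \<ominus> p \<otimes> (w \<otimes> z \<ominus> u \<otimes> f) \<in> K"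
      using ideal.I_l_closed[OF K v(2) w] ideal.I_l_closed[OF K wz pc] by (rule ideal_diff[OF K])
    moreover have "w \<otimes> (p \<otimes> z \<ominus> v \<otimes> f) \<ominus> p \<otimes> (w \<otimes> z \<ominus> u \<otimes> f) = (p \<otimes> u \<ominus> w \<otimes> v) \<otimes> f"
      using w u zc pc v(1) f by algebra
    ultimately have "p \<otimes> u \<ominus> w \<otimes> v \<in> colon R K f"
      using w u pc v(1) by (simp add: colon_iff)
    then have "q \<otimes> (p \<otimes> u \<ominus> w \<otimes> v) \<in> K" using s ideal_prod.prod[OF Jq, of _ _ R] by blast
    then have "\<ominus> (q \<otimes> (p \<otimes> u \<ominus> w \<otimes> v)) \<in> K" by (rule ideal_uminus[OF K])
    moreover have "\<ominus> (q \<otimes> (p \<otimes> u \<ominus> w \<otimes> v)) = w \<otimes> (q \<otimes> v) \<ominus> u \<otimes> (p \<otimes> q)"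
      using w u pc qc v(1) by algebra
    ultimately show ?thesis by simp
  qed
  \<comment> \<open>The additional factor \<open>J\<close> is spent here. From
    \<open>z g \<in> K\<close> it follows that \<open>v g \<in> K : f\<close>, hence
    \<open>J^s v\<close> lies in \<open>K : g\<close> and \<open>J^(s+1) v\<close> in
    \<open>J (K : g)\<close>.\<close>
  moreover have "q \<otimes> v \<in> J \<cdot> colon R K g" if zg: "z \<in> colon R K g"
  proof -
    have Kg: "ideal (colon R K g) R" using K g by (rule colon_ideal)
    have "z \<otimes> g \<in> K" using zg by (simp add: colon_iff)
    then have "p \<otimes> (z \<otimes> g) \<ominus> g \<otimes> (p \<otimes> z \<ominus> v \<otimes> f) \<in> K"
      using ideal.I_l_closed[OF K _ pc] ideal.I_l_closed[OF K v(2) g] by (intro ideal_diff[OF K])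
    moreover have "p \<otimes> (z \<otimes> g) \<ominus> g \<otimes> (p \<otimes> z \<ominus> v \<otimes> f) = (v \<otimes> g) \<otimes> f"
      using pc zc v(1) f g by algebra
    ultimately have vg: "v \<otimes> g \<in> colon R K f" using v(1) g by (simp add: colon_iff)
    show ?thesis
    proof (rule ideal_prod_mem_colonI[of _ _ J "Jpow s"])
      show "ideal (J \<cdot> colon R K g) R" by (intro ideal_prod_is_ideal J Kg)
      show "q \<in> J \<cdot> Jpow s" using prod(2) ideal_pow_Suc'[OF J] by simp
      fix j r assume j: "j \<in> J" and r: "r \<in> Jpow s"
      have jc: "j \<in> carrier R" and rc: "r \<in> carrier R"
        using j r J Jpow_carrier by (auto dest: ideal.Icarr)
      have "r \<otimes> (v \<otimes> g) \<in> K" using s ideal_prod.prod[OF r vg, of R] by blast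
      then have "r \<otimes> v \<in> colon R K g" using rc v(1) g by (simp add: colon_iff m_assoc)
      then have "j \<otimes> (r \<otimes> v) \<in> J \<cdot> colon R K g" by (rule ideal_prod.prod[OF j])
      then show "(j \<otimes> r) \<otimes> v \<in> J \<cdot> colon R K g" using jc rc v(1) by (simp add: m_assoc)
    qed (use v(1) J Jpow_ideal in \<open>auto dest: ideal_subset\<close>)
  qed
  ultimately show ?case
    using qc v(1) by (intro bexI[of _ "q \<otimes> v"]) auto
next
  case (sum e1 e2)
  have zc: "z \<in> carrier R" using z by (auto simp: colon_iff)
  have ec: "e1 \<in> carrier R" "e2 \<in> carrier R"
    using sum.hyps ideal_prod_in_carrier[OF Jpow_ideal Jpow_ideal] by auto
  obtain t1 where t1: "t1 \<in> carrier R"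
    "\<And>w u. w \<in> carrier R \<Longrightarrow> u \<in> carrier R \<Longrightarrow> w \<otimes> z \<ominus> u \<otimes> f \<in> K \<Longrightarrow> w \<otimes> t1 \<ominus> u \<otimes> e1 \<in> K"
    "z \<in> colon R K g \<Longrightarrow> t1 \<in> J \<cdot> colon R K g"
    using sum.IH(1) by blast
  obtain t2 where t2: "t2 \<in> carrier R"
    "\<And>w u. w \<in> carrier R \<Longrightarrow> u \<in> carrier R \<Longrightarrow> w \<otimes> z \<ominus> u \<otimes> f \<in> K \<Longrightarrow> w \<otimes> t2 \<ominus> u \<otimes> e2 \<in> K"
    "z \<in> colon R K g \<Longrightarrow> t2 \<in> J \<cdot> colon R K g"
    using sum.IH(2) by blast
  have "w \<otimes> (t1 \<oplus> t2) \<ominus> u \<otimes> (e1 \<oplus> e2) \<in> K"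
    if w: "w \<in> carrier R" and u: "u \<in> carrier R" and wz: "w \<otimes> z \<ominus> u \<otimes> f \<in> K" for w u
  proof -
    have "w \<otimes> (t1 \<oplus> t2) \<ominus> u \<otimes> (e1 \<oplus> e2) = (w \<otimes> t1 \<ominus> u \<otimes> e1) \<oplus> (w \<otimes> t2 \<ominus> u \<otimes> e2)"
      using w u t1(1) t2(1) ec by algebra
    then show ?thesis
      using ideal_add[OF K t1(2)[OF that] t2(2)[OF that]] by simp
  qed
  then show ?case
    using t1 t2 by (intro bexI[of _ "t1 \<oplus> t2"]) (auto intro: ideal_prod.sum)
qed

text \<open>With \<open>T\<close> the elements that \<open>J^n\<close> multiplies into
  \<open>K + (f + e)\<close>, the claim is that the new colon ideal lies in \<open>T\<close>.
  Corrected elements \<open>z + t\<close> of the old colon lie in \<open>T\<close>, since a relation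
  \<open>w z = u f\<close> modulo \<open>K\<close> turns into \<open>w (z + t) = u (f + e)\<close>.
  It remains that they exhaust the new colon up to \<open>K : g\<close>, and that
  \<open>K : g\<close> lies in \<open>T\<close>.\<close>

lemma colon_perturb_annihilator:
  assumes K: "ideal K R" and f: "f \<in> carrier R" and g: "g \<in> carrier R"
    and s: "Jpow s \<cdot> colon R K f \<subseteq> K"
    and a: "Jpow a \<cdot> colon R (K <+> PIdl f) g \<subseteq> K <+> PIdl f"
    and e: "e \<in> Jpow N" and N: "s + a < N"
    and swap: "colon R (K <+> PIdl g) (f \<oplus> e) \<subseteq> colon R (K <+> PIdl g) f"
    and n: "Jpow n \<cdot> colon R (K <+> PIdl f) g \<subseteq> K <+> PIdl f"
  shows "Jpow n \<cdot> colon R (K <+> PIdl (f \<oplus> e)) g \<subseteq> K <+> PIdl (f \<oplus> e)"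
proof -
  let ?f = "f \<oplus> e"
  let ?E = "K <+> PIdl f" and ?E' = "K <+> PIdl ?f"
  have ec: "e \<in> carrier R" using e by (rule Jpow_carrier)
  have fc: "?f \<in> carrier R" using f ec by simp
  have E': "ideal ?E' R" using K fc by (intro add_ideals cgenideal_ideal)
  have "e \<in> Jpow (a + Suc s)" using e N ideal_pow_antimono[OF J, of "a + Suc s" N] by auto
  then have eJ: "e \<in> Jpow a \<cdot> Jpow (Suc s)" unfolding ideal_pow_add[OF J] .
  define T where "T = {x \<in> carrier R. \<forall>w\<in>Jpow n. w \<otimes> x \<in> ?E'}"
  have T: "ideal T R"
  proof (rule idealI')
    show "\<zero> \<in> T" using E' Jpow_carrier by (auto simp: T_def ideal_zero)
    show "x \<oplus> y \<in> T" if "x \<in> T" "y \<in> T" for x y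
      using that E' Jpow_carrier by (auto simp: T_def r_distr ideal_add)
    show "c \<otimes> x \<in> T" if c: "c \<in> carrier R" and x: "x \<in> T" for c x
    proof -
      have "w \<otimes> (c \<otimes> x) = c \<otimes> (w \<otimes> x)" if "w \<in> Jpow n" for w
        using c x Jpow_carrier[OF that] by (simp add: T_def m_lcomm)
      then show ?thesis using c x by (auto simp: T_def ideal.I_l_closed[OF E'])
    qed
  qed (auto simp: T_def)
  have correct: "\<exists>t\<in>carrier R. z \<oplus> t \<in> T
    \<and> (\<forall>u\<in>carrier R. g \<otimes> z \<ominus> u \<otimes> f \<in> K \<longrightarrow> g \<otimes> t \<ominus> u \<otimes> e \<in> K)
    \<and> (z \<in> colon R K g \<longrightarrow> t \<in> J \<cdot> colon R K g)" if z: "z \<in> colon R ?E g" for z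
  proof -
    have zc: "z \<in> carrier R" using z by (auto simp: colon_iff)
    obtain t where t: "t \<in> carrier R"
      "\<And>w u. w \<in> carrier R \<Longrightarrow> u \<in> carrier R \<Longrightarrow> w \<otimes> z \<ominus> u \<otimes> f \<in> K \<Longrightarrow> w \<otimes> t \<ominus> u \<otimes> e \<in> K"
      "z \<in> colon R K g \<longrightarrow> t \<in> J \<cdot> colon R K g"
      using colon_correction[OF K f g s a z eJ] by blast
    have "w \<otimes> (z \<oplus> t) \<in> ?E'" if w: "w \<in> Jpow n" for w
    proof -
      have wc: "w \<in> carrier R" using w by (rule Jpow_carrier)
      have "w \<otimes> z \<in> ?E" using n ideal_prod.prod[OF w z, of R] by blast
      then obtain u where u: "u \<in> carrier R" "w \<otimes> z \<ominus> u \<otimes> f \<in> K"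
        using adjoin_iff[OF K f, of "w \<otimes> z"] wc zc by auto
      have "(w \<otimes> z \<ominus> u \<otimes> f) \<oplus> (w \<otimes> t \<ominus> u \<otimes> e) \<in> K"
        using u(2) t(2)[OF wc u] by (rule ideal_add[OF K])
      moreover have "(w \<otimes> z \<ominus> u \<otimes> f) \<oplus> (w \<otimes> t \<ominus> u \<otimes> e) = w \<otimes> (z \<oplus> t) \<ominus> u \<otimes> ?f"
        using wc zc t(1) u(1) f ec by algebra
      ultimately show ?thesis
        using adjoin_iff[OF K fc, of "w \<otimes> (z \<oplus> t)"] u(1) wc zc t(1) by auto
    qed
    then have "z \<oplus> t \<in> T" using zc t(1) by (simp add: T_def)
    then show ?thesis using t g by blast
  qed
  have Kg: "ideal (colon R K g) R" using K g by (rule colon_ideal)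
  have KgE: "colon R K g \<subseteq> colon R ?E g"
    using set_add_left[OF K cgenideal_ideal[OF f]] by (auto simp: colon_iff)
  \<comment> \<open>For \<open>z \<in> K : g\<close> the correction \<open>t\<close> is in
    \<open>J (K : g)\<close>, so \<open>z = (z + t) - t\<close> gives
    \<open>K : g \<subseteq> T + J (K : g)\<close>.\<close>
  have KgT: "colon R K g \<subseteq> T"
  proof (rule nakayama[OF Kg T], rule subsetI)
    fix z assume z: "z \<in> colon R K g"
    then obtain t where t: "t \<in> carrier R" "z \<oplus> t \<in> T" "t \<in> J \<cdot> colon R K g"
      using correct[of z] KgE by blast
    have "\<ominus> t \<in> J \<cdot> colon R K g"
      using t(3) by (rule ideal_uminus[OF ideal_prod_is_ideal[OF J Kg]])
    moreover have "z = (z \<oplus> t) \<oplus> (\<ominus> t)"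
      using z t(1) by (auto simp: colon_iff a_assoc r_neg)
    ultimately show "z \<in> T <+> J \<cdot> colon R K g" using t(2) by (metis set_addI)
  qed
  have "colon R ?E' g \<subseteq> T"
  proof
    fix x assume "x \<in> colon R ?E' g"
    then have xc: "x \<in> carrier R" and "x \<otimes> g \<in> ?E'" by (auto simp: colon_iff)
    then obtain u where u: "u \<in> carrier R" "x \<otimes> g \<ominus> u \<otimes> ?f \<in> K"
      using adjoin_iff[OF K fc, of "x \<otimes> g"] g by auto
    have "\<ominus> (x \<otimes> g \<ominus> u \<otimes> ?f) \<in> K" using u(2) by (rule ideal_uminus[OF K])
    moreover have "\<ominus> (x \<otimes> g \<ominus> u \<otimes> ?f) = u \<otimes> ?f \<ominus> x \<otimes> g" using xc u(1) g fc by algebra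
    ultimately have "u \<otimes> ?f \<in> K <+> PIdl g"
      using adjoin_iff[OF K g, of "u \<otimes> ?f"] xc u(1) fc by auto
    \<comment> \<open>Source of surjectivity: \<open>swap\<close> lets the coefficient
      \<open>u\<close> of \<open>f + e\<close> serve as a coefficient of \<open>f\<close>, which
      yields \<open>z\<close> in the old colon with \<open>z g = u f\<close> modulo
      \<open>K\<close>. Then \<open>t g = u e\<close>, so \<open>x\<close> and \<open>z + t\<close>
      have the same product with \<open>g\<close> modulo \<open>K\<close>.\<close>
    then have "u \<in> colon R (K <+> PIdl g) f" using u(1) swap by (auto simp: colon_iff)
    then obtain z where z: "z \<in> carrier R" "u \<otimes> f \<ominus> z \<otimes> g \<in> K"
      using adjoin_iff[OF K g, of "u \<otimes> f"] u(1) f by (auto simp: colon_iff)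
    have "\<ominus> (u \<otimes> f \<ominus> z \<otimes> g) \<in> K" using z(2) by (rule ideal_uminus[OF K])
    moreover have "\<ominus> (u \<otimes> f \<ominus> z \<otimes> g) = z \<otimes> g \<ominus> u \<otimes> f" using z(1) u(1) g f by algebra
    ultimately have zg: "z \<otimes> g \<ominus> u \<otimes> f \<in> K" by simp
    then have "z \<in> colon R ?E g"
      using adjoin_iff[OF K f, of "z \<otimes> g"] z(1) u(1) g by (auto simp: colon_iff)
    then obtain t where t: "t \<in> carrier R" "z \<oplus> t \<in> T"
      and gt: "\<And>u. u \<in> carrier R \<Longrightarrow> g \<otimes> z \<ominus> u \<otimes> f \<in> K \<Longrightarrow> g \<otimes> t \<ominus> u \<otimes> e \<in> K"
      using correct[of z] by blast
    have "g \<otimes> t \<ominus> u \<otimes> e \<in> K" using gt[OF u(1)] zg g z(1) by (simp add: m_comm)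
    then have "((x \<otimes> g \<ominus> u \<otimes> ?f) \<ominus> (z \<otimes> g \<ominus> u \<otimes> f)) \<ominus> (g \<otimes> t \<ominus> u \<otimes> e) \<in> K"
      by (rule ideal_diff[OF K ideal_diff[OF K u(2) zg]])
    moreover have "((x \<otimes> g \<ominus> u \<otimes> ?f) \<ominus> (z \<otimes> g \<ominus> u \<otimes> f)) \<ominus> (g \<otimes> t \<ominus> u \<otimes> e) = (x \<ominus> (z \<oplus> t)) \<otimes> g"
      using xc u(1) z(1) t(1) f g ec by algebra
    ultimately have "x \<ominus> (z \<oplus> t) \<in> colon R K g"
      using xc z(1) t(1) by (simp add: colon_iff)
    then have "(x \<ominus> (z \<oplus> t)) \<oplus> (z \<oplus> t) \<in> T"
      using ideal_add[OF T subsetD[OF KgT] t(2)] by blast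
    moreover have "(x \<ominus> (z \<oplus> t)) \<oplus> (z \<oplus> t) = x" using xc z(1) t(1) by algebra
    ultimately show "x \<in> T" by simp
  qed
  then show ?thesis
    by (intro ideal_prod_least E') (auto simp: T_def)
qed

end

subsection \<open>Loewy lengths of quotients of ideals\<close>

context cring
begin

lemma ideal_coset_eq:
  assumes "ideal B R" "x \<in> carrier R" "y \<in> carrier R"
  shows "B +> x = B +> y \<longleftrightarrow> x \<ominus> y \<in> B"
  using quotient_eq_iff_same_a_r_cos[OF assms] by simp

lemma ideal_coset_eq_self:
  assumes "ideal B R" "x \<in> carrier R"
  shows "B +> x = B \<longleftrightarrow> x \<in> B"
proof -
  have "x \<ominus> \<zero> = x" using assms(2) by algebra
  moreover have "B +> \<zero> = B" using assms(1) by (simp add: ideal_subset)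
  ultimately show ?thesis
    using ideal_coset_eq[OF assms zero_closed] by simp
qed

lemma coset_iff: "y \<in> B +> x \<longleftrightarrow> (\<exists>b\<in>B. y = b \<oplus> x)"
  by (auto simp: a_r_coset_def')

lemma quot_smult_coset:
  assumes B: "ideal B R" and r: "r \<in> carrier R" and x: "x \<in> carrier R"
  shows "r \<odot>\<^bsub>quot_module R A B\<^esub> (B +> x) = B +> (r \<otimes> x)"
proof -
  have const: "B +> (r \<otimes> y) = B +> (r \<otimes> x)" if y: "y \<in> B +> x" for y
  proof -
    obtain b where b: "b \<in> B" "y = b \<oplus> x" using y by (auto simp: coset_iff)
    have bc: "b \<in> carrier R" using B b(1) by (rule ideal.Icarr)
    have "r \<otimes> y \<ominus> r \<otimes> x = r \<otimes> b" unfolding b(2) using r x bc by algebra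
    then have "r \<otimes> y \<ominus> r \<otimes> x \<in> B" using ideal.I_l_closed[OF B b(1) r] by simp
    moreover have "y \<in> carrier R" unfolding b(2) using bc x by simp
    ultimately show ?thesis
      using ideal_coset_eq[OF B, of "r \<otimes> y" "r \<otimes> x"] r x by blast
  qed
  have "x \<in> B +> x"
    using ideal_zero[OF B] x by (auto simp: coset_iff intro!: bexI[of _ \<zero>])
  then have "(\<Union>y\<in>B +> x. B +> (r \<otimes> y)) = B +> (r \<otimes> x)"
    by (rule UN_constant_eq) (rule ballI, rule const)
  then show ?thesis by (simp add: quot_module_def)
qed

text \<open>Eliminates the quotient module: Loewy lengths become statements about inclusions of
  ideals in \<open>R\<close>.\<close>

lemma ideal_smult_quot_module_eq_zero:
  assumes A: "ideal A R" and B: "ideal B R" and K: "ideal K R"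
  shows "ideal_smult K (quot_module R A B) = {\<zero>\<^bsub>quot_module R A B\<^esub>} \<longleftrightarrow> K \<cdot> A \<subseteq> B"
proof -
  let ?M = "quot_module R A B"
  define H where "H = {k \<odot>\<^bsub>?M\<^esub> m | k m. k \<in> K \<and> m \<in> carrier ?M}"
  have H: "H = {B +> (k \<otimes> x) | k x. k \<in> K \<and> x \<in> A}"
  proof -
    have smult: "k \<odot>\<^bsub>?M\<^esub> (B +> x) = B +> (k \<otimes> x)" if "k \<in> K" "x \<in> A" for k x
      using ideal.Icarr[OF K that(1)] ideal.Icarr[OF A that(2)] by (rule quot_smult_coset[OF B])
    have carr: "carrier ?M = (\<lambda>x. B +> x) ` A" by (simp add: quot_module_def)
    show ?thesis
    proof (intro equalityI subsetI)
      fix y assume "y \<in> H"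
      then obtain k m where k: "k \<in> K" and m: "m \<in> carrier ?M" and y: "y = k \<odot>\<^bsub>?M\<^esub> m"
        unfolding H_def by blast
      obtain x where x: "x \<in> A" "m = B +> x" using m unfolding carr by (rule imageE)
      show "y \<in> {B +> (k \<otimes> x) | k x. k \<in> K \<and> x \<in> A}"
        using smult[OF k x(1)] k x(1) unfolding y x(2) by (intro CollectI exI conjI)
    next
      fix y assume "y \<in> {B +> (k \<otimes> x) | k x. k \<in> K \<and> x \<in> A}"
      then obtain k x where k: "k \<in> K" and x: "x \<in> A" and y: "y = B +> (k \<otimes> x)" by blast
      have "B +> x \<in> carrier ?M" unfolding carr using x by (rule imageI)
      then show "y \<in> H"
        unfolding H_def y smult[OF k x, symmetric] using k by (intro CollectI exI conjI) (rule refl)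
    qed
  qed
  have coset_add: "B <+> (B +> x) = B +> x" if "x \<in> carrier R" for x
    using ideal.a_rcos_sum[OF B zero_closed that] B that by (simp add: ideal_subset)
  have BB: "B <+> B = B" using coset_add[OF zero_closed] B by (simp add: ideal_subset)
  \<comment> \<open>\<open>generate\<close> also adjoins inverses. \<open>?M\<close> has not been
    shown to have a group as its additive monoid, so the inverse of the zero coset is computed from
    its definite description.\<close>
  have inv: "inv\<^bsub>add_monoid ?M\<^esub> B = B"
  proof -
    have "y = B" if "y \<in> (\<lambda>x. B +> x) ` A" "B <+> y = B" for y
      using that coset_add A by (auto dest: ideal.Icarr)
    moreover have "B \<in> (\<lambda>x. B +> x) ` A"
      using ideal_zero[OF A] B by (intro image_eqI[of _ _ \<zero>]) (simp_all add: ideal_subset)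
    ultimately show ?thesis
      unfolding m_inv_def using BB by (intro the_equality) (auto simp: quot_module_def)
  qed
  have "generate (add_monoid ?M) H = {B} \<longleftrightarrow> H \<subseteq> {B}"
  proof
    show "H \<subseteq> {B}" if "generate (add_monoid ?M) H = {B}"
      using that generate.incl[of _ H "add_monoid ?M"] by auto
    assume H: "H \<subseteq> {B}"
    have "x = B" if "x \<in> generate (add_monoid ?M) H" for x
      using that
    proof induction
      case (inv h)
      then show ?case using H assms \<open>inv\<^bsub>add_monoid ?M\<^esub> B = B\<close> by auto
    qed (use H BB in \<open>auto simp: quot_module_def\<close>)
    moreover have "B \<in> generate (add_monoid ?M) H"
      using generate.one[of "add_monoid ?M" H] by (simp add: quot_module_def)
    ultimately show "generate (add_monoid ?M) H = {B}" by auto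
  qed
  also have "H \<subseteq> {B} \<longleftrightarrow> (\<forall>k\<in>K. \<forall>x\<in>A. k \<otimes> x \<in> B)"
  proof -
    have "B +> (k \<otimes> x) = B \<longleftrightarrow> k \<otimes> x \<in> B" if "k \<in> K" "x \<in> A" for k x
      using ideal.Icarr[OF K that(1)] ideal.Icarr[OF A that(2)]
        by (intro ideal_coset_eq_self[OF B]) simp
    moreover have "H \<subseteq> {B} \<longleftrightarrow> (\<forall>k\<in>K. \<forall>x\<in>A. B +> (k \<otimes> x) = B)"
      unfolding H subset_iff mem_Collect_eq singleton_iff by metis
    ultimately show ?thesis by simp
  qed
  also have "\<dots> \<longleftrightarrow> K \<cdot> A \<subseteq> B"
  proof
    show "K \<cdot> A \<subseteq> B" if "\<forall>k\<in>K. \<forall>x\<in>A. k \<otimes> x \<in> B"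
      using that by (intro ideal_prod_least[OF B]) auto
    show "\<forall>k\<in>K. \<forall>x\<in>A. k \<otimes> x \<in> B" if "K \<cdot> A \<subseteq> B"
      using that by (auto intro: ideal_prod.prod)
  qed
  finally show ?thesis
    by (simp add: ideal_smult_def H_def quot_module_def)
qed

lemma colon_loewy_eq:
  assumes J: "ideal J R" and f: "f ` {1..i} \<subseteq> carrier R" and i: "i \<ge> 1"
  shows "colon_loewy R J f i = Inf {enat n | n.
    ideal_pow R J n \<cdot> colon R (seq_ideal R f (i - 1)) (f i) \<subseteq> seq_ideal R f (i - 1)}"
proof -
  have S: "ideal (seq_ideal R f (i - 1)) R"
    unfolding seq_ideal_def using f by (intro genideal_ideal) (auto simp: image_subset_iff)
  have "f i \<in> carrier R" using f i by auto
  then have C: "ideal (colon R (seq_ideal R f (i - 1)) (f i)) R" by (rule colon_ideal[OF S])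
  show ?thesis
    unfolding colon_loewy_def loewy_length_def
      ideal_smult_quot_module_eq_zero[OF C S ideal_pow_ideal[OF J]] by (rule refl)
qed

end

lemma Inf_enat_attained:
  assumes "Inf {enat n | n. P n} = enat k"
  shows "P k"
proof -
  let ?A = "{enat n | n. P n}"
  have "?A \<noteq> {}"
  proof
    assume "?A = {}"
    then show False using assms by (simp add: Inf_enat_def)
  qed
  then have "Inf ?A \<in> ?A"
    unfolding Inf_enat_def by (auto intro: LeastI)
  then show ?thesis using assms by auto
qed

subsection \<open>Perturbing a sequence one element at a time\<close>

context noetherian_local_ring_ideal
begin

text \<open>The right-hand side says that, from degree \<open>c\<close> on, the initial ideal is
  generated from the preceding degree by \<open>J/J^2\<close>; this depends on the initial ideal
  alone. It recovers the equality in \<open>R\<close> because the errors have ever higher order and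
  Krull's theorem removes them.\<close>

lemma ar_bound_iff_graded:
  assumes I: "ideal I R"
  shows "ar_bound I c \<longleftrightarrow> (\<forall>n\<ge>c. (I \<inter> Jpow (n + 1)) <+> Jpow (n + 2)
    \<subseteq> J \<cdot> ((I \<inter> Jpow n) <+> Jpow (n + 1)) <+> Jpow (n + 2))"
proof
  have I': "ideal (I \<inter> Jpow n) R" for n by (rule i_intersect[OF I Jpow_ideal])
  have G: "ideal ((I \<inter> Jpow n) <+> Jpow (n + 1)) R" for n by (rule add_ideals[OF I' Jpow_ideal])
  assume c: "ar_bound I c"
  show "\<forall>n\<ge>c. (I \<inter> Jpow (n + 1)) <+> Jpow (n + 2)
    \<subseteq> J \<cdot> ((I \<inter> Jpow n) <+> Jpow (n + 1)) <+> Jpow (n + 2)"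
  proof (intro allI impI set_add_mono order_refl)
    fix n assume "n \<ge> c"
    then have "I \<inter> Jpow (n + 1) = J \<cdot> (I \<inter> Jpow n)"
      using c by (simp add: ar_bound_def Int_commute)
    also have "\<dots> \<subseteq> J \<cdot> ((I \<inter> Jpow n) <+> Jpow (n + 1))"
      by (intro ideal_prod_mono order_refl set_add_left[OF I' Jpow_ideal])
    finally show "I \<inter> Jpow (n + 1) \<subseteq> J \<cdot> ((I \<inter> Jpow n) <+> Jpow (n + 1))" .
  qed
next
  have I': "ideal (I \<inter> Jpow n) R" for n by (rule i_intersect[OF I Jpow_ideal])
  have JI: "ideal (J \<cdot> (I \<inter> Jpow n)) R" for n by (rule ideal_prod_is_ideal[OF J I'])
  assume graded: "\<forall>n\<ge>c. (I \<inter> Jpow (n + 1)) <+> Jpow (n + 2)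
    \<subseteq> J \<cdot> ((I \<inter> Jpow n) <+> Jpow (n + 1)) <+> Jpow (n + 2)"
  have step: "y \<in> J \<cdot> (I \<inter> Jpow n) <+> (I \<inter> Jpow (n + 2))"
    if n: "n \<ge> c" and y: "y \<in> I \<inter> Jpow (n + 1)" for y n
  proof -
    have prod: "J \<cdot> ((I \<inter> Jpow n) <+> Jpow (n + 1)) = J \<cdot> (I \<inter> Jpow n) <+> Jpow (n + 2)"
      using ideal_prod_r_distr[OF J I' Jpow_ideal] ideal_pow_Suc'[OF J, of "n + 1"] by simp
    have "y \<in> J \<cdot> ((I \<inter> Jpow n) <+> Jpow (n + 1)) <+> Jpow (n + 2)"
      using subsetD[OF set_add_left[OF I' Jpow_ideal] y] graded n by blast
    also have "\<dots> \<subseteq> J \<cdot> (I \<inter> Jpow n) <+> Jpow (n + 2)"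
      unfolding prod
      by (intro set_add_least order_refl set_add_right[OF JI Jpow_ideal] add_ideals[OF JI Jpow_ideal])
    finally obtain p q where p: "p \<in> J \<cdot> (I \<inter> Jpow n)" and q: "q \<in> Jpow (n + 2)" and yp: "y = p \<oplus> q"
      by (rule set_addE)
    have carr: "p \<in> carrier R" "q \<in> carrier R"
      using ideal.Icarr[OF JI p] Jpow_carrier[OF q] by auto
    have "p \<in> I" using p ideal_prod_inter[OF J I'] by auto
    then have "y \<ominus> p \<in> I" using y by (intro ideal_diff[OF I]) auto
    moreover have "y \<ominus> p = q" unfolding yp using carr by algebra
    ultimately show ?thesis
      unfolding yp using p q by (intro set_addI) auto
  qed
  have "I \<inter> Jpow (n + 1) \<subseteq> J \<cdot> (I \<inter> Jpow n)" if n: "n \<ge> c" for n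
  proof
    fix x assume x: "x \<in> I \<inter> Jpow (n + 1)"
    show "x \<in> J \<cdot> (I \<inter> Jpow n)"
    proof (rule krull_intersection[OF JI])
      fix m
      \<comment> \<open>The error is pushed from order \<open>n + m + 1\<close> to
        \<open>n + m + 2\<close>. The products split off lie in
        \<open>J (I \<inter> J^(n+m))\<close>, which is absorbed by the fixed ideal
        \<open>J (I \<inter> J^n)\<close>.\<close>
      have "x \<in> J \<cdot> (I \<inter> Jpow n) <+> (I \<inter> Jpow (n + m + 1))"
      proof (induction m)
        case 0
        then show ?case using subsetD[OF set_add_right[OF JI I'] x] by simp
      next
        case (Suc m)
        then obtain t y where t: "t \<in> J \<cdot> (I \<inter> Jpow n)" and y: "y \<in> I \<inter> Jpow (n + m + 1)"
          and xe: "x = t \<oplus> y" by (rule set_addE)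
        have "y \<in> J \<cdot> (I \<inter> Jpow (n + m)) <+> (I \<inter> Jpow (n + m + 2))"
          using step[of "n + m" y] n y by simp
        then obtain p q where p: "p \<in> J \<cdot> (I \<inter> Jpow (n + m))" and q: "q \<in> I \<inter> Jpow (n + m + 2)"
          and ye: "y = p \<oplus> q" by (rule set_addE)
        have "J \<cdot> (I \<inter> Jpow (n + m)) \<subseteq> J \<cdot> (I \<inter> Jpow n)"
          using ideal_pow_antimono[OF J, of n "n + m"] by (intro ideal_prod_mono) auto
        then have tp: "t \<oplus> p \<in> J \<cdot> (I \<inter> Jpow n)" using t p by (intro ideal_add[OF JI]) auto
        have "x = (t \<oplus> p) \<oplus> q"
          unfolding xe ye using ideal.Icarr[OF JI t] ideal.Icarr[OF JI p] ideal.Icarr[OF I' q]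
          by (simp add: a_assoc)
        then show ?case using tp q by (auto intro!: set_addI)
      qed
      also have "\<dots> \<subseteq> J \<cdot> (I \<inter> Jpow n) <+> Jpow m"
        using ideal_pow_antimono[OF J, of m "n + m + 1"] by (intro set_add_mono) auto
      finally show "x \<in> J \<cdot> (I \<inter> Jpow n) <+> Jpow m" .
    qed
  qed
  moreover have "J \<cdot> (I \<inter> Jpow n) \<subseteq> I \<inter> Jpow (n + 1)" for n
  proof -
    have "J \<cdot> (I \<inter> Jpow n) \<subseteq> Jpow (n + 1)"
      using ideal_pow_Suc'[OF J, of n] ideal_prod_mono[of J J "I \<inter> Jpow n" "Jpow n"] by simp
    moreover have "J \<cdot> (I \<inter> Jpow n) \<subseteq> I"
      using ideal_prod_inter[OF J I'] by auto
    ultimately show ?thesis by auto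
  qed
  ultimately show "ar_bound I c"
    unfolding ar_bound_def Int_commute[of _ I] by (intro allI impI equalityI)
qed

lemma ar_bound_same_initial:
  assumes "ideal E R" "ideal E' R" "same_initial E E'"
  shows "ar_bound E = ar_bound E'"
proof
  fix c
  have "(E \<inter> Jpow n) <+> Jpow (n + 1) = (E' \<inter> Jpow n) <+> Jpow (n + 1)" for n
    using assms(3) by (simp add: same_initial_def)
  from this this[of "n + 1" for n] show "ar_bound E c = ar_bound E' c"
    unfolding ar_bound_iff_graded[OF assms(1)] ar_bound_iff_graded[OF assms(2)] by simp
qed

lemma artin_rees_same_initial:
  assumes "ideal E R" "ideal E' R" "same_initial E E'"
  shows "artin_rees R J E = artin_rees R J E'"
  using ar_bound_same_initial[OF assms] unfolding ar_bound_def artin_rees_def by metis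

text \<open>As a predicate in \<open>n\<close> this is the set whose infimum is the Loewy length, so
  equality of the predicates for two sequences yields equal lengths.\<close>

definition annihilates :: "(nat \<Rightarrow> 'a) \<Rightarrow> nat \<Rightarrow> nat \<Rightarrow> bool" where
  "annihilates f i n \<longleftrightarrow>
    Jpow n \<cdot> colon R (seq_ideal R f (i - 1)) (f i) \<subseteq> seq_ideal R f (i - 1)"

abbreviation idl_without :: "(nat \<Rightarrow> 'a) \<Rightarrow> nat \<Rightarrow> nat \<Rightarrow> 'a set" where
  "idl_without f i j \<equiv> Idl (f ` ({1..i} - {j}))"

section \<open>Splitting off one element of the sequence\<close>

lemma seq_ideal_ideal: "f ` {1..r} \<subseteq> carrier R \<Longrightarrow> i \<le> r \<Longrightarrow> ideal (seq_ideal R f i) R"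
  unfolding seq_ideal_def by (intro genideal_ideal) (auto simp: image_subset_iff)

lemma idl_without_ideal: "f ` {1..r} \<subseteq> carrier R \<Longrightarrow> i \<le> r \<Longrightarrow> ideal (idl_without f i j) R"
  by (intro genideal_ideal) (auto simp: image_subset_iff)

lemma seq_ideal_eq_adjoin:
  assumes "f ` {1..r} \<subseteq> carrier R" "i \<le> r" "j \<in> {1..i}"
  shows "seq_ideal R f i = idl_without f i j <+> PIdl (f j)"
proof -
  have "f ` {1..i} = insert (f j) (f ` ({1..i} - {j}))" using assms(3) by blast
  then show ?thesis
    unfolding seq_ideal_def using assms
    by (subst genideal_insert[symmetric]) (auto simp: image_subset_iff)
qed

lemma idl_without_Suc:
  assumes "f ` {1..r} \<subseteq> carrier R" "Suc i \<le> r" "j \<le> i"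
  shows "idl_without f (Suc i) j = idl_without f i j <+> PIdl (f (Suc i))"
proof -
  have "{1..Suc i} - {j} = insert (Suc i) ({1..i} - {j})" using assms(3) by auto
  then show ?thesis
    using assms by (subst genideal_insert[symmetric]) (auto simp: image_subset_iff)
qed

lemma idl_without_self: "1 \<le> j \<Longrightarrow> idl_without f j j = seq_ideal R f (j - 1)"
proof -
  assume "1 \<le> j"
  then have "{1..j} - {j} = {1..j - 1}" by auto
  then show ?thesis by (simp add: seq_ideal_def)
qed

text \<open>The element \<open>f j\<close> starts as the last one, over the elements before it, and
  every further \<open>f (i + 1)\<close> is swapped past it by \<open>colon_swap\<close>, which adds
  \<open>a (i + 1)\<close> to the exponent. Summing from 1 makes the exponent independent of
  \<open>j\<close>.\<close>

lemma annihilator_idl_without: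
  assumes f: "f ` {1..r} \<subseteq> carrier R" and a: "\<And>i. i \<in> {1..r} \<Longrightarrow> annihilates f i (a i)"
    and j: "1 \<le> j" "j \<le> i" "i \<le> r"
  shows "Jpow (\<Sum>l = 1..i. a l) \<cdot> colon R (idl_without f i j) (f j) \<subseteq> idl_without f i j"
  using j(2,3)
proof (induction i rule: dec_induct)
  case base
  have "a j \<le> (\<Sum>l = 1..j. a l)"
    using j(1) by (intro member_le_sum) auto
  then have "Jpow (\<Sum>l = 1..j. a l) \<cdot> colon R (idl_without f j j) (f j)
      \<subseteq> Jpow (a j) \<cdot> colon R (idl_without f j j) (f j)"
    by (intro ideal_prod_mono ideal_pow_antimono[OF J] order_refl)
  also have "\<dots> \<subseteq> idl_without f j j"
    using a[of j] j(1) base unfolding annihilates_def idl_without_self[OF j(1)] by simp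
  finally show ?case .
next
  case (step i)
  let ?K = "idl_without f i j"
  have i: "i \<le> r" "Suc i \<le> r" using step.prems by auto
  have K: "ideal ?K R" by (rule idl_without_ideal[OF f i(1)])
  have fj: "f j \<in> carrier R" and fi: "f (Suc i) \<in> carrier R"
    using f j(1) step.hyps i by (auto simp: image_subset_iff)
  have "seq_ideal R f i = ?K <+> PIdl (f j)"
    using seq_ideal_eq_adjoin[OF f i(1), of j] j(1) step.hyps by simp
  then have "Jpow (a (Suc i)) \<cdot> colon R (?K <+> PIdl (f j)) (f (Suc i)) \<subseteq> ?K <+> PIdl (f j)"
    using a[of "Suc i"] i by (simp add: annihilates_def)
  from colon_swap[OF K fj fi step.IH[OF i(1)] this] show ?case
    unfolding idl_without_Suc[OF f i(2) step.hyps(1)] by simp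
qed

lemma same_initial_refl: "same_initial E E"
  by (simp add: same_initial_def)

lemma same_initial_trans: "same_initial E F \<Longrightarrow> same_initial F G \<Longrightarrow> same_initial E G"
  by (simp add: same_initial_def)

text \<open>Nothing changes for \<open>i < j\<close>; for \<open>i = j\<close> the colon ideal
  itself is preserved; for \<open>i > j\<close> the annihilating exponents are compared in both
  directions. The initial ideals for \<open>i \<ge> j\<close> come from
  \<open>initial_perturb\<close> over the ideal omitting \<open>f j\<close>.\<close>

lemma perturb_one:
  assumes f: "f ` {1..r} \<subseteq> carrier R" and a: "\<And>i. i \<in> {1..r} \<Longrightarrow> annihilates f i (a i)"
    and ar: "\<And>i. i \<in> {1..r} \<Longrightarrow> \<exists>c<N. ar_bound (seq_ideal R f i) c"
    and N: "(\<Sum>l = 1..r. a l) < N"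
    and j: "j \<in> {1..r}" and e: "e \<in> Jpow N" and i: "i \<in> {1..r}"
  defines "h \<equiv> f(j := f j \<oplus> e)"
  shows "annihilates h i = annihilates f i" (is ?A)
    and "same_initial (seq_ideal R f i) (seq_ideal R h i)" (is ?S)
proof -
  have ec: "e \<in> carrier R" using e by (rule Jpow_carrier)
  have fj: "f j \<in> carrier R" using f j by (auto simp: image_subset_iff)
  have h: "h ` {1..r} \<subseteq> carrier R"
    using f ec fj by (auto simp: h_def image_subset_iff)
  have without: "idl_without h k j = idl_without f k j" for k
    by (rule arg_cong[of _ _ "genideal R"], rule image_cong) (auto simp: h_def)
  have below: "seq_ideal R h k = seq_ideal R f k" if "k < j" for k
    unfolding seq_ideal_def using that
    by (intro arg_cong[of _ _ "genideal R"] image_cong) (auto simp: h_def)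
  have adjoin: "seq_ideal R f k = idl_without f k j <+> PIdl (f j)"
    "seq_ideal R h k = idl_without f k j <+> PIdl (f j \<oplus> e)" if "j \<le> k" "k \<le> r" for k
    using seq_ideal_eq_adjoin[OF f that(2), of j] seq_ideal_eq_adjoin[OF h that(2), of j] that j
    by (auto simp: without h_def)
  have sums: "(\<Sum>l = 1..k. a l) < N" if "k \<le> r" for k
  proof -
    have "(\<Sum>l = 1..k. a l) \<le> (\<Sum>l = 1..r. a l)" using that by (intro sum_mono2) auto
    then show ?thesis using N by simp
  qed
  have Kid: "ideal (idl_without f k j) R" if "k \<le> r" for k
    by (rule idl_without_ideal[OF f that])
  have ann: "Jpow (\<Sum>l = 1..k. a l) \<cdot> colon R (idl_without f k j) (f j) \<subseteq> idl_without f k j"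
    if "j \<le> k" "k \<le> r" for k
    using that j by (intro annihilator_idl_without[OF f a]) auto
  have colon_eq: "colon R (idl_without f k j) (f j \<oplus> e) = colon R (idl_without f k j) (f j)"
    and initial_eq: "same_initial (seq_ideal R f k) (seq_ideal R h k)" if k: "j \<le> k" "k \<le> r" for k
  proof -
    obtain c where c: "c < N" "ar_bound (idl_without f k j <+> PIdl (f j)) c"
      using ar[of k] adjoin(1)[OF k] j k by auto
    show "colon R (idl_without f k j) (f j \<oplus> e) = colon R (idl_without f k j) (f j)"
      by (rule colon_perturb[OF Kid[OF k(2)] fj e ann[OF k] sums[OF k(2)] c(2,1)])
    show "same_initial (seq_ideal R f k) (seq_ideal R h k)"
      unfolding adjoin[OF k]
      by (rule initial_perturb[OF Kid[OF k(2)] fj e ann[OF k] sums[OF k(2)] c(2,1)])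
  qed
  show ?S
  proof (cases "i < j")
    case True
    then show ?thesis using below[of i] by (simp add: same_initial_refl)
  next
    case False
    then show ?thesis using initial_eq[of i] i by simp
  qed
  consider "i < j" | "i = j" | "j < i" by linarith
  then show ?A
  proof cases
    case 1
    then have "h i = f i" "seq_ideal R h (i - 1) = seq_ideal R f (i - 1)"
      using below[of "i - 1"] by (auto simp: h_def)
    then show ?thesis unfolding annihilates_def by (intro ext) simp
  next
    case 2
    have "seq_ideal R h (j - 1) = seq_ideal R f (j - 1)" "h j = f j \<oplus> e"
      using below[of "j - 1"] j by (auto simp: h_def)
    moreover have "colon R (seq_ideal R f (j - 1)) (f j \<oplus> e) = colon R (seq_ideal R f (j - 1)) (f j)"
    proof -
      have "idl_without f j j = seq_ideal R f (j - 1)" using j by (intro idl_without_self) simp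
      from colon_eq[of j, unfolded this] j show ?thesis by simp
    qed
    ultimately show ?thesis
      unfolding 2 annihilates_def by (intro ext) simp
  next
    case 3
    define k where "k = i - 1"
    have k: "j \<le> k" "k \<le> r" "i = Suc k" "Suc k \<le> r" using 3 i by (auto simp: k_def)
    define K where "K = idl_without f k j"
    define g where "g = f i"
    have hg: "h i = g" using 3 by (simp add: h_def g_def)
    have gc: "g \<in> carrier R" using f i by (auto simp: g_def image_subset_iff)
    have K: "ideal K R" unfolding K_def by (rule Kid[OF k(2)])
    have fe: "f j \<oplus> e \<in> carrier R" using fj ec by simp
    have Kf: "seq_ideal R f k = K <+> PIdl (f j)" and Kh: "seq_ideal R h k = K <+> PIdl (f j \<oplus> e)"
      unfolding K_def by (rule adjoin[OF k(1,2)])+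
    have Kg: "idl_without f i j = K <+> PIdl g"
      unfolding K_def g_def k(3) by (rule idl_without_Suc[OF f k(4,1)])
    \<comment> \<open>Since \<open>K + (g)\<close> is again an ideal omitting \<open>f j\<close>,
      now with \<open>i\<close> in place of \<open>k\<close>, the colon of the perturbed element
      over it is already known.\<close>
    have swap: "colon R (K <+> PIdl g) (f j \<oplus> e) = colon R (K <+> PIdl g) (f j)"
      using colon_eq[of i] 3 i unfolding Kg by simp
    have Kcolon: "colon R K (f j \<oplus> e) = colon R K (f j)"
      unfolding K_def by (rule colon_eq[OF k(1,2)])
    have s: "Jpow (\<Sum>l = 1..k. a l) \<cdot> colon R K (f j) \<subseteq> K"
      unfolding K_def by (rule ann[OF k(1,2)])
    have af: "annihilates f i n \<longleftrightarrow> Jpow n \<cdot> colon R (K <+> PIdl (f j)) g \<subseteq> K <+> PIdl (f j)" for n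
      unfolding annihilates_def Kf[symmetric] by (simp add: k_def g_def)
    have ah: "annihilates h i n \<longleftrightarrow> Jpow n \<cdot> colon R (K <+> PIdl (f j \<oplus> e)) g \<subseteq> K <+> PIdl (f j \<oplus> e)" for n
      unfolding annihilates_def Kh[symmetric] hg by (simp add: k_def)
    have Nk: "(\<Sum>l = 1..k. a l) + a i < N"
      using sums[of i] i unfolding k(3) by simp
    note s' = s[folded Kcolon]
    have forward: "annihilates f i n \<Longrightarrow> annihilates h i n" for n
      using colon_perturb_annihilator[OF K fj gc s _ e Nk] a[OF i] swap unfolding af ah by blast
    have cancel: "(f j \<oplus> e) \<oplus> (\<ominus> e) = f j" using fj ec by algebra
    \<comment> \<open>Now \<open>f j + e\<close> is perturbed by \<open>- e\<close>. The colon over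
      \<open>K\<close> is unchanged, and the exponent \<open>a i\<close> is available for
      \<open>h\<close> by the direction just proved.\<close>
    have "annihilates h i n \<Longrightarrow> annihilates f i n" for n
      using colon_perturb_annihilator[OF K fe gc s' _ ideal_uminus[OF Jpow_ideal e] Nk]
        forward[OF a[OF i]] swap
      unfolding af ah cancel by blast
    with forward show ?thesis by blast
  qed
qed

text \<open>In the intermediate sequence \<open>g j\<close> the first \<open>j\<close> entries are
  the new ones. Entry \<open>j + 1\<close> is still the original \<open>f (j + 1)\<close>, so the
  given \<open>e (j + 1)\<close> is the next perturbation.\<close>

lemma perturb_sequence:
  assumes f: "f ` {1..r} \<subseteq> carrier R" and a: "\<And>i. i \<in> {1..r} \<Longrightarrow> annihilates f i (a i)"
    and ar: "\<And>i. i \<in> {1..r} \<Longrightarrow> \<exists>c<N. ar_bound (seq_ideal R f i) c"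
    and N: "(\<Sum>l = 1..r. a l) < N"
    and e: "\<And>i. i \<in> {1..r} \<Longrightarrow> e i \<in> Jpow N"
    and f': "\<And>i. i \<in> {1..r} \<Longrightarrow> f' i = f i \<oplus> e i"
    and i: "i \<in> {1..r}"
  shows "annihilates f' i = annihilates f i \<and> same_initial (seq_ideal R f i) (seq_ideal R f' i)"
proof -
  define g where "g j i = (if i \<le> j then f' i else f i)" for j i :: nat
  have f'c: "f' i \<in> carrier R" if "i \<in> {1..r}" for i
    using f'[OF that] Jpow_carrier[OF e[OF that]] f that by (auto simp: image_subset_iff)
  have gc: "g j ` {1..r} \<subseteq> carrier R" for j
    using f f'c by (auto simp: g_def image_subset_iff)
  have "\<forall>i\<in>{1..r}. annihilates (g j) i = annihilates f i
      \<and> same_initial (seq_ideal R f i) (seq_ideal R (g j) i)" if "j \<le> r" for j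
    using that
  proof (induction j)
    case 0
    have seq: "seq_ideal R (g 0) k = seq_ideal R f k" for k
      unfolding seq_ideal_def
      by (intro arg_cong[of _ _ "genideal R"] image_cong) (auto simp: g_def)
    have "g 0 i = f i" if "i \<in> {1..r}" for i using that by (simp add: g_def)
    then show ?case
      by (simp add: annihilates_def seq same_initial_refl fun_eq_iff)
  next
    case (Suc j)
    have g_Suc: "g (Suc j) = (g j)(Suc j := g j (Suc j) \<oplus> e (Suc j))"
      using Suc.prems f'[of "Suc j"] by (auto simp: g_def fun_eq_iff)
    have IH: "annihilates (g j) i = annihilates f i"
      "same_initial (seq_ideal R f i) (seq_ideal R (g j) i)" if "i \<in> {1..r}" for i
      using Suc that by auto
    \<comment> \<open>The Artin-Rees bounds of the original sequence carry over because the initial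
      ideals have stayed the same, so \<open>N\<close> never has to grow.\<close>
    have arg: "\<exists>c<N. ar_bound (seq_ideal R (g j) i) c" if "i \<in> {1..r}" for i
      using ar[OF that] ar_bound_same_initial[OF seq_ideal_ideal[OF f] seq_ideal_ideal[OF gc] IH(2)[OF that]] that
      by auto
    have ag: "annihilates (g j) i (a i)" if "i \<in> {1..r}" for i
      using a IH(1) that by simp
    have j: "Suc j \<in> {1..r}" using Suc.prems by simp
    show ?case
    proof
      fix i assume i: "i \<in> {1..r}"
      show "annihilates (g (Suc j)) i = annihilates f i
        \<and> same_initial (seq_ideal R f i) (seq_ideal R (g (Suc j)) i)"
        unfolding g_Suc
        using perturb_one[OF gc ag arg N j e[OF j] i] IH[OF i] same_initial_trans by auto
    qed
  qed
  then have r: "annihilates (g r) i = annihilates f i"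
    "same_initial (seq_ideal R f i) (seq_ideal R (g r) i)"
    using i by auto
  have seq: "seq_ideal R (g r) k = seq_ideal R f' k" if "k \<le> r" for k
    unfolding seq_ideal_def using that
    by (intro arg_cong[of _ _ "genideal R"] image_cong) (auto simp: g_def)
  have "g r i = f' i" "i - 1 \<le> r" "i \<le> r" using i by (auto simp: g_def)
  then have "annihilates (g r) i = annihilates f' i"
    unfolding annihilates_def by (intro ext) (simp add: seq)
  with r show ?thesis using seq[OF \<open>i \<le> r\<close>] by simp
qed

end

subsection \<open>The associated graded ring\<close>

definition gr_coset ::
  "('a, 'b) ring_scheme \<Rightarrow> 'a set \<Rightarrow> 'a set \<Rightarrow> (nat \<Rightarrow> 'a) \<Rightarrow> nat \<Rightarrow> 'a set" where
  "gr_coset R J I x n = gr_filt R J I (n + 1) +>\<^bsub>R\<^esub> x n"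

text \<open>Representatives come from \<open>J^n\<close> and not from \<open>J^n + I\<close>, so one
  sequence represents an element in the graded rings of all quotients \<open>R/I\<close> at once.
  Finite support depends on \<open>I\<close> and is imposed on the cosets.\<close>

definition gr_rep :: "('a, 'b) ring_scheme \<Rightarrow> 'a set \<Rightarrow> (nat \<Rightarrow> 'a) set" where
  "gr_rep R J = {x. \<forall>n. x n \<in> ideal_pow R J n}"

lemma (in cring) mult_diff_mult:
  assumes "a \<in> carrier R" "b \<in> carrier R" "c \<in> carrier R" "d \<in> carrier R"
  shows "(a \<ominus> c) \<otimes> b \<oplus> c \<otimes> (b \<ominus> d) = a \<otimes> b \<ominus> c \<otimes> d"
  using assms by algebra

lemma (in cring) add_eq_diff_add_add:
  assumes "t \<in> carrier R" "s \<in> carrier R" "z \<in> carrier R"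
  shows "t \<oplus> z = ((t \<ominus> s) \<oplus> z) \<oplus> s"
  using assms by algebra

lemma (in cring) finsum_congruent:
  assumes "ideal B R" "finite A"
    and "\<And>i. i \<in> A \<Longrightarrow> p i \<in> carrier R" "\<And>i. i \<in> A \<Longrightarrow> q i \<in> carrier R"
    and "\<And>i. i \<in> A \<Longrightarrow> p i \<ominus> q i \<in> B"
  shows "(\<Oplus>i\<in>A. p i) \<ominus> (\<Oplus>i\<in>A. q i) \<in> B"
  using assms(2-)
proof (induction A rule: finite_induct)
  case empty
  then show ?case using ideal_zero[OF assms(1)] by (simp add: a_minus_def)
next
  case (insert a A)
  have carr: "finsum R p A \<in> carrier R" "finsum R q A \<in> carrier R" "p a \<in> carrier R" "q a \<in> carrier R"
    using insert.prems by (auto intro: finsum_closed)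
  have "finsum R p (insert a A) = p a \<oplus> finsum R p A" "finsum R q (insert a A) = q a \<oplus> finsum R q A"
    using insert.hyps insert.prems by (auto intro!: finsum_insert)
  moreover have "(p a \<oplus> finsum R p A) \<ominus> (q a \<oplus> finsum R q A)
      = (p a \<ominus> q a) \<oplus> (finsum R p A \<ominus> finsum R q A)"
    using carr by algebra
  moreover have "(p a \<ominus> q a) \<oplus> (finsum R p A \<ominus> finsum R q A) \<in> B"
    using insert.IH insert.prems by (intro ideal_add[OF assms(1)]) auto
  ultimately show ?case by simp
qed

lemma (in cring) finsum_mem_ideal:
  assumes "ideal B R" "finite A" "\<And>i. i \<in> A \<Longrightarrow> p i \<in> B"
  shows "(\<Oplus>i\<in>A. p i) \<in> B"
  using assms(2,3)
proof (induction A rule: finite_induct)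
  case empty
  then show ?case using ideal_zero[OF assms(1)] by simp
next
  case (insert a A)
  have "finsum R p (insert a A) = p a \<oplus> finsum R p A"
    using insert.hyps insert.prems ideal.Icarr[OF assms(1)] by (auto intro!: finsum_insert)
  then show ?case using insert by (auto intro: ideal_add[OF assms(1)])
qed

context cring
begin

context
  fixes J I
  assumes J: "ideal J R" and I: "ideal I R"
begin

lemma gr_filt_ideal: "ideal (gr_filt R J I n) R"
  unfolding gr_filt_def by (intro add_ideals ideal_pow_ideal J I)

lemma gr_filt_Suc_subset: "gr_filt R J I (n + 1) \<subseteq> gr_filt R J I n"
  unfolding gr_filt_def by (intro set_add_mono ideal_pow_antimono[OF J]) auto

lemma gr_filt_superset: "ideal_pow R J n \<subseteq> gr_filt R J I n" "I \<subseteq> gr_filt R J I n"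
  unfolding gr_filt_def by (intro set_add_left set_add_right ideal_pow_ideal J I)+

lemma gr_filt_mult:
  assumes x: "x \<in> gr_filt R J I m" and y: "y \<in> gr_filt R J I n"
  shows "x \<otimes> y \<in> gr_filt R J I (m + n)"
proof -
  obtain p i where p: "p \<in> ideal_pow R J m" and i: "i \<in> I" and xe: "x = p \<oplus> i"
    using x unfolding gr_filt_def by (rule set_addE)
  obtain q k where q: "q \<in> ideal_pow R J n" and k: "k \<in> I" and ye: "y = q \<oplus> k"
    using y unfolding gr_filt_def by (rule set_addE)
  have carr: "p \<in> carrier R" "q \<in> carrier R" "i \<in> carrier R" "k \<in> carrier R"
    using ideal_pow_carrier[OF J p] ideal_pow_carrier[OF J q] ideal.Icarr[OF I] i k by auto
  have "x \<otimes> y = p \<otimes> q \<oplus> (p \<otimes> k \<oplus> (q \<oplus> k) \<otimes> i)"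
    unfolding xe ye using carr by algebra
  moreover have "p \<otimes> q \<in> ideal_pow R J (m + n)" using J p q by (rule ideal_pow_mult)
  moreover have "p \<otimes> k \<oplus> (q \<oplus> k) \<otimes> i \<in> I"
    using ideal_add[OF I] ideal.I_l_closed[OF I] i k carr by simp
  ultimately show ?thesis unfolding gr_filt_def by (simp add: set_addI)
qed

lemma gr_rep_carrier: "x \<in> gr_rep R J \<Longrightarrow> x n \<in> carrier R"
  using ideal_pow_carrier[OF J] by (auto simp: gr_rep_def)

lemma gr_coset_self: "x \<in> gr_rep R J \<Longrightarrow> x n \<in> gr_coset R J I x n"
  using ideal_zero[OF gr_filt_ideal] gr_rep_carrier[of x n]
  by (auto simp: gr_coset_def coset_iff intro!: bexI[of _ \<zero>])

lemma gr_coset_eq_iff: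
  assumes "x \<in> gr_rep R J" "y \<in> gr_rep R J"
  shows "gr_coset R J I x n = gr_coset R J I y n \<longleftrightarrow> x n \<ominus> y n \<in> gr_filt R J I (n + 1)"
  unfolding gr_coset_def using assms by (intro ideal_coset_eq gr_filt_ideal gr_rep_carrier)

lemma gr_coset_zero_iff:
  assumes "x \<in> gr_rep R J"
  shows "gr_coset R J I x n = gr_filt R J I (n + 1) \<longleftrightarrow> x n \<in> gr_filt R J I (n + 1)"
  unfolding gr_coset_def using assms by (intro ideal_coset_eq_self gr_filt_ideal gr_rep_carrier)

lemma gr_carrier:
  "carrier (assoc_graded R J I) =
    {u \<in> gr_coset R J I ` gr_rep R J. finite {n. u n \<noteq> gr_filt R J I (n + 1)}}"
proof (intro equalityI subsetI)
  fix u assume "u \<in> carrier (assoc_graded R J I)"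
  then have u: "\<And>n. u n \<in> (\<lambda>x. gr_filt R J I (n + 1) +> x) ` gr_filt R J I n"
    and fin: "finite {n. u n \<noteq> gr_filt R J I (n + 1)}"
    by (auto simp: assoc_graded_def quot_dsum_def)
  have "\<exists>p\<in>ideal_pow R J n. u n = gr_filt R J I (n + 1) +> p" for n
  proof -
    obtain y where y: "y \<in> gr_filt R J I n" and un: "u n = gr_filt R J I (n + 1) +> y"
      using u[of n] by (rule imageE)
    obtain p i where p: "p \<in> ideal_pow R J n" and i: "i \<in> I" and ye: "y = p \<oplus> i"
      using y unfolding gr_filt_def by (rule set_addE)
    have carr: "p \<in> carrier R" "i \<in> carrier R"
      using ideal_pow_carrier[OF J p] ideal.Icarr[OF I i] by auto
    have "y \<ominus> p = i" unfolding ye using carr by algebra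
    then have "y \<ominus> p \<in> gr_filt R J I (n + 1)" using gr_filt_superset(2) i by auto
    moreover have "y \<in> carrier R" unfolding ye using carr by simp
    ultimately have "u n = gr_filt R J I (n + 1) +> p"
      unfolding un using carr by (subst ideal_coset_eq[OF gr_filt_ideal]) auto
    then show ?thesis using p by blast
  qed
  then obtain x where x: "\<And>n. x n \<in> ideal_pow R J n" "\<And>n. u n = gr_filt R J I (n + 1) +> x n"
    by metis
  then have "u = gr_coset R J I x" "x \<in> gr_rep R J"
    by (auto simp: gr_coset_def gr_rep_def fun_eq_iff)
  with fin show "u \<in> {u \<in> gr_coset R J I ` gr_rep R J. finite {n. u n \<noteq> gr_filt R J I (n + 1)}}"
    by blast
next
  fix u assume "u \<in> {u \<in> gr_coset R J I ` gr_rep R J. finite {n. u n \<noteq> gr_filt R J I (n + 1)}}"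
  then obtain x where x: "x \<in> gr_rep R J" and u: "u = gr_coset R J I x"
    and fin: "finite {n. u n \<noteq> gr_filt R J I (n + 1)}" by blast
  have "x n \<in> gr_filt R J I n" for n
    using x gr_filt_superset(1)[of n] by (auto simp: gr_rep_def)
  then have "u n \<in> (\<lambda>x. gr_filt R J I (n + 1) +> x) ` gr_filt R J I n" for n
    unfolding u gr_coset_def by (rule imageI)
  with fin show "u \<in> carrier (assoc_graded R J I)"
    by (simp add: assoc_graded_def quot_dsum_def)
qed

lemma gr_add:
  assumes "x \<in> gr_rep R J" "y \<in> gr_rep R J"
  shows "gr_coset R J I x \<oplus>\<^bsub>assoc_graded R J I\<^esub> gr_coset R J I y = gr_coset R J I (\<lambda>n. x n \<oplus> y n)"
  using ideal.a_rcos_sum[OF gr_filt_ideal gr_rep_carrier[OF assms(1)] gr_rep_carrier[OF assms(2)]]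
  by (simp add: assoc_graded_def gr_coset_def fun_eq_iff)

text \<open>Changing representatives alters a product by \<open>(x' - x) y' + x (y' - y)\<close>,
  and each summand lies one filtration step deeper. Conversely, fixed representatives already give
  the whole coset as \<open>z\<close> varies.\<close>

lemma gr_mult:
  assumes x: "x \<in> gr_rep R J" and y: "y \<in> gr_rep R J"
  shows "gr_coset R J I x \<otimes>\<^bsub>assoc_graded R J I\<^esub> gr_coset R J I y
    = gr_coset R J I (\<lambda>n. \<Oplus>i\<in>{..n}. x i \<otimes> y (n - i))"
proof
  fix n
  let ?B = "gr_filt R J I (n + 1)"
  let ?s = "\<Oplus>i\<in>{..n}. x i \<otimes> y (n - i)"
  have B: "ideal ?B R" by (rule gr_filt_ideal)
  note xc = gr_rep_carrier[OF x] and yc = gr_rep_carrier[OF y]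
  have sc: "?s \<in> carrier R" using xc yc by (intro finsum_closed) auto
  define M where "M = {(\<Oplus>i\<in>{..n}. x' i \<otimes> y' (n - i)) \<oplus> z | x' y' z.
    (\<forall>i\<le>n. x' i \<in> gr_coset R J I x i \<and> y' i \<in> gr_coset R J I y i) \<and> z \<in> ?B}"
  have "M = ?B +> ?s"
  proof (intro equalityI subsetI)
    fix w assume "w \<in> M"
    then obtain x' y' z where xy: "\<And>i. i \<le> n \<Longrightarrow> x' i \<in> gr_coset R J I x i"
      "\<And>i. i \<le> n \<Longrightarrow> y' i \<in> gr_coset R J I y i"
      and z: "z \<in> ?B" and w: "w = (\<Oplus>i\<in>{..n}. x' i \<otimes> y' (n - i)) \<oplus> z"
      unfolding M_def by blast
    have rep: "v \<in> gr_filt R J I i \<and> v \<ominus> a i \<in> gr_filt R J I (i + 1)"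
      if a: "a \<in> gr_rep R J" and v: "v \<in> gr_coset R J I a i" for a v i
    proof -
      obtain b where b: "b \<in> gr_filt R J I (i + 1)" and ve: "v = b \<oplus> a i"
        using v by (auto simp: gr_coset_def coset_iff)
      have bc: "b \<in> carrier R" using b by (rule ideal.Icarr[OF gr_filt_ideal])
      have "v \<ominus> a i = b" unfolding ve using bc gr_rep_carrier[OF a, of i] by algebra
      moreover have "v \<in> gr_filt R J I i"
        unfolding ve using b gr_filt_Suc_subset[of i] gr_filt_superset(1)[of i] a
        by (intro ideal_add[OF gr_filt_ideal]) (auto simp: gr_rep_def)
      ultimately show ?thesis using b by simp
    qed
    have carr: "x' i \<in> carrier R" "y' i \<in> carrier R" if "i \<le> n" for i
      using rep[OF x xy(1)[OF that]] rep[OF y xy(2)[OF that]] ideal.Icarr[OF gr_filt_ideal] by blast+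
    have "x' i \<otimes> y' (n - i) \<ominus> x i \<otimes> y (n - i) \<in> ?B" if i: "i \<le> n" for i
    proof -
      have "(x' i \<ominus> x i) \<otimes> y' (n - i) \<in> gr_filt R J I ((i + 1) + (n - i))"
        using rep[OF x xy(1)[OF i]] rep[OF y xy(2), of "n - i"] by (intro gr_filt_mult) auto
      moreover have "x i \<otimes> (y' (n - i) \<ominus> y (n - i)) \<in> gr_filt R J I (i + ((n - i) + 1))"
        using rep[OF x gr_coset_self[OF x], of i] rep[OF y xy(2), of "n - i"]
        by (intro gr_filt_mult) auto
      ultimately have "(x' i \<ominus> x i) \<otimes> y' (n - i) \<oplus> x i \<otimes> (y' (n - i) \<ominus> y (n - i)) \<in> ?B"
        using i by (intro ideal_add[OF B]) simp_all
      moreover have "(x' i \<ominus> x i) \<otimes> y' (n - i) \<oplus> x i \<otimes> (y' (n - i) \<ominus> y (n - i))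
          = x' i \<otimes> y' (n - i) \<ominus> x i \<otimes> y (n - i)"
        using carr(1)[OF i] carr(2)[OF diff_le_self, of i] xc[of i] yc[of "n - i"]
        by (rule mult_diff_mult)
      ultimately show ?thesis by simp
    qed
    then have diff: "(\<Oplus>i\<in>{..n}. x' i \<otimes> y' (n - i)) \<ominus> ?s \<in> ?B"
      using carr xc yc by (intro finsum_congruent[OF B]) auto
    define t where "t = (\<Oplus>i\<in>{..n}. x' i \<otimes> y' (n - i))"
    have tc: "t \<in> carrier R" unfolding t_def using carr by (intro finsum_closed) auto
    have zc: "z \<in> carrier R" using z by (rule ideal.Icarr[OF B])
    have "w = ((t \<ominus> ?s) \<oplus> z) \<oplus> ?s"
      unfolding w t_def[symmetric] using tc sc zc by (rule add_eq_diff_add_add)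
    moreover have "(t \<ominus> ?s) \<oplus> z \<in> ?B"
      using diff z unfolding t_def by (rule ideal_add[OF B])
    ultimately show "w \<in> ?B +> ?s" unfolding coset_iff by blast
  next
    fix w assume "w \<in> ?B +> ?s"
    then obtain b where b: "b \<in> ?B" and w: "w = b \<oplus> ?s" unfolding coset_iff by blast
    have "w = ?s \<oplus> b" unfolding w using ideal.Icarr[OF B b] sc by (rule a_comm)
    then show "w \<in> M"
      unfolding M_def using b gr_coset_self[OF x] gr_coset_self[OF y]
      by (intro CollectI exI[of _ x] exI[of _ y] exI[of _ b]) auto
  qed
  then show "(gr_coset R J I x \<otimes>\<^bsub>assoc_graded R J I\<^esub> gr_coset R J I y) n
      = gr_coset R J I (\<lambda>n. \<Oplus>i\<in>{..n}. x i \<otimes> y (n - i)) n"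
    by (simp add: assoc_graded_def M_def gr_coset_def)
qed

lemma gr_one: "\<one>\<^bsub>assoc_graded R J I\<^esub> = gr_coset R J I (\<lambda>n. if n = 0 then \<one> else \<zero>)"
  using ideal_subset[OF gr_filt_ideal] by (auto simp: assoc_graded_def gr_coset_def fun_eq_iff)

end

section \<open>Comparing the graded rings of two quotients\<close>

lemma gr_rep_add:
  "ideal J R \<Longrightarrow> x \<in> gr_rep R J \<Longrightarrow> y \<in> gr_rep R J \<Longrightarrow> (\<lambda>n. x n \<oplus> y n) \<in> gr_rep R J"
  by (auto simp: gr_rep_def intro: ideal_add[OF ideal_pow_ideal])

lemma gr_rep_mult:
  assumes J: "ideal J R" and x: "x \<in> gr_rep R J" and y: "y \<in> gr_rep R J"
  shows "(\<lambda>n. \<Oplus>i\<in>{..n}. x i \<otimes> y (n - i)) \<in> gr_rep R J"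
proof -
  have "x i \<otimes> y (n - i) \<in> ideal_pow R J n" if "i \<in> {..n}" for i n
    using ideal_pow_mult[OF J, of "x i" i "y (n - i)" "n - i"] x y that by (simp add: gr_rep_def)
  then show ?thesis
    unfolding gr_rep_def by (auto intro: finsum_mem_ideal[OF ideal_pow_ideal[OF J]])
qed

lemma gr_rep_one: "ideal J R \<Longrightarrow> (\<lambda>n. if n = 0 then \<one> else \<zero>) \<in> gr_rep R J"
  by (auto simp: gr_rep_def ideal_zero[OF ideal_pow_ideal])

text \<open>Modular law: \<open>J^n \<inter> (J^(n+1) + I)\<close> equals
  \<open>(I \<inter> J^n) + J^(n+1)\<close>. This identifies the kernel of the map from the graded
  ring of \<open>R\<close> to that of \<open>R/I\<close> with the initial ideal.\<close>

lemma gr_filt_Suc_iff: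
  assumes J: "ideal J R" and I: "ideal I R" and x: "x \<in> ideal_pow R J n"
  shows "x \<in> gr_filt R J I (n + 1) \<longleftrightarrow> x \<in> (I \<inter> ideal_pow R J n) <+> ideal_pow R J (n + 1)"
proof
  assume "x \<in> gr_filt R J I (n + 1)"
  then obtain p i where p: "p \<in> ideal_pow R J (n + 1)" and i: "i \<in> I" and xe: "x = p \<oplus> i"
    unfolding gr_filt_def by (rule set_addE)
  have carr: "p \<in> carrier R" "i \<in> carrier R"
    using ideal_pow_carrier[OF J p] ideal.Icarr[OF I i] by auto
  have "p \<in> ideal_pow R J n" using p ideal_pow_antimono[OF J, of n "n + 1"] by auto
  then have "x \<ominus> p \<in> ideal_pow R J n" using x by (intro ideal_diff[OF ideal_pow_ideal[OF J]])
  moreover have "x \<ominus> p = i" unfolding xe using carr by algebra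
  moreover have "x = i \<oplus> p" unfolding xe using carr by (rule a_comm)
  ultimately show "x \<in> (I \<inter> ideal_pow R J n) <+> ideal_pow R J (n + 1)"
    using i p by (auto intro: set_addI)
next
  assume "x \<in> (I \<inter> ideal_pow R J n) <+> ideal_pow R J (n + 1)"
  then obtain i p where p: "p \<in> ideal_pow R J (n + 1)" and i: "i \<in> I \<inter> ideal_pow R J n" and xe:
    "x = i \<oplus> p"
    by (rule set_addE)
  have "x = p \<oplus> i"
    unfolding xe using ideal_pow_carrier[OF J p] ideal.Icarr[OF I] i by (intro a_comm) auto
  then show "x \<in> gr_filt R J I (n + 1)"
    unfolding gr_filt_def using p i by (auto intro: set_addI)
qed

text \<open>The isomorphism keeps the representing sequence and changes the ideal. By
  \<open>gr_filt_Suc_iff\<close> two sequences are congruent modulo one filtration exactly when they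
  are modulo the other, which gives well-definedness, injectivity and preservation of
  degrees.\<close>

lemma gr_isomorphic_same_initial:
  assumes J: "ideal J R" and I: "ideal I R" and I': "ideal I' R"
    and init: "\<And>n. (I \<inter> ideal_pow R J n) <+> ideal_pow R J (n + 1)
      = (I' \<inter> ideal_pow R J n) <+> ideal_pow R J (n + 1)"
  shows "gr_isomorphic R J I I'"
proof -
  let ?c = "gr_coset R J I" and ?c' = "gr_coset R J I'" and ?D = "gr_rep R J"
  have filt: "x \<in> gr_filt R J I (n + 1) \<longleftrightarrow> x \<in> gr_filt R J I' (n + 1)" if "x \<in> ideal_pow R J n" for x n
    using gr_filt_Suc_iff[OF J I that] gr_filt_Suc_iff[OF J I' that] init by simp
  have same: "?c x n = ?c y n \<longleftrightarrow> ?c' x n = ?c' y n" if "x \<in> ?D" "y \<in> ?D" for x y n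
  proof -
    have "x n \<ominus> y n \<in> ideal_pow R J n"
      using that ideal_diff[OF ideal_pow_ideal[OF J]] by (simp add: gr_rep_def)
    then show ?thesis
      using gr_coset_eq_iff[OF J I that] gr_coset_eq_iff[OF J I' that] filt by simp
  qed
  have zero: "?c x n = gr_filt R J I (n + 1) \<longleftrightarrow> ?c' x n = gr_filt R J I' (n + 1)" if "x \<in> ?D" for x n
    using gr_coset_zero_iff[OF J I that] gr_coset_zero_iff[OF J I' that] filt[of "x n" n] that
    by (simp add: gr_rep_def)
  \<comment> \<open>A representing sequence is chosen arbitrarily; by \<open>same\<close> the result
    does not depend on the choice.\<close>
  define h where "h u = ?c' (SOME x. x \<in> ?D \<and> u = ?c x)" for u
  have h: "h (?c x) = ?c' x" if x: "x \<in> ?D" for x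
  proof -
    define y where "y = (SOME y. y \<in> ?D \<and> ?c x = ?c y)"
    have "\<exists>y. y \<in> ?D \<and> ?c x = ?c y" using x by blast
    then have "y \<in> ?D \<and> ?c x = ?c y" unfolding y_def by (rule someI_ex)
    then have "?c' y = ?c' x" using same[of x y] x by (metis ext)
    then show ?thesis unfolding h_def y_def .
  qed
  have carr: "u \<in> carrier (assoc_graded R J I) \<longleftrightarrow> (\<exists>x\<in>?D. u = ?c x \<and> finite {n. ?c x n \<noteq> gr_filt R J I (n + 1)})" for u
    unfolding gr_carrier[OF J I] by blast
  have carr': "u \<in> carrier (assoc_graded R J I') \<longleftrightarrow> (\<exists>x\<in>?D. u = ?c' x \<and> finite {n. ?c' x n \<noteq> gr_filt R J I' (n + 1)})" for u
    unfolding gr_carrier[OF J I'] by blast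
  have "h \<in> ring_hom (assoc_graded R J I) (assoc_graded R J I')"
  proof (rule ring_hom_memI)
    fix u assume "u \<in> carrier (assoc_graded R J I)"
    then obtain x where x: "x \<in> ?D" "u = ?c x" "finite {n. ?c x n \<noteq> gr_filt R J I (n + 1)}"
      unfolding carr by blast
    then show "h u \<in> carrier (assoc_graded R J I')"
      unfolding carr' using h[OF x(1)] zero[OF x(1)] by auto
    fix v assume "v \<in> carrier (assoc_graded R J I)"
    then obtain y where y: "y \<in> ?D" "v = ?c y" unfolding carr by blast
    show "h (u \<otimes>\<^bsub>assoc_graded R J I\<^esub> v) = h u \<otimes>\<^bsub>assoc_graded R J I'\<^esub> h v"
      unfolding x(2) y(2) gr_mult[OF J I x(1) y(1)] h[OF x(1)] h[OF y(1)] gr_mult[OF J I' x(1) y(1)]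
      by (rule h[OF gr_rep_mult[OF J x(1) y(1)]])
    show "h (u \<oplus>\<^bsub>assoc_graded R J I\<^esub> v) = h u \<oplus>\<^bsub>assoc_graded R J I'\<^esub> h v"
      unfolding x(2) y(2) gr_add[OF J I x(1) y(1)] h[OF x(1)] h[OF y(1)] gr_add[OF J I' x(1) y(1)]
      by (rule h[OF gr_rep_add[OF J x(1) y(1)]])
  next
    show "h \<one>\<^bsub>assoc_graded R J I\<^esub> = \<one>\<^bsub>assoc_graded R J I'\<^esub>"
      unfolding gr_one[OF J I] gr_one[OF J I'] by (rule h[OF gr_rep_one[OF J]])
  qed
  moreover have "bij_betw h (carrier (assoc_graded R J I)) (carrier (assoc_graded R J I'))"
  proof (rule bij_betw_imageI)
    show "inj_on h (carrier (assoc_graded R J I))"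
    proof (rule inj_onI)
      fix u v assume uv: "u \<in> carrier (assoc_graded R J I)" "v \<in> carrier (assoc_graded R J I)"
        "h u = h v"
      obtain x where x: "x \<in> ?D" "u = ?c x" using uv(1) unfolding carr by blast
      obtain y where y: "y \<in> ?D" "v = ?c y" using uv(2) unfolding carr by blast
      have "?c' x = ?c' y" using uv(3) unfolding x(2) y(2) h[OF x(1)] h[OF y(1)] .
      then show "u = v" unfolding x(2) y(2) using same[OF x(1) y(1)] by (metis ext)
    qed
    show "h ` carrier (assoc_graded R J I) = carrier (assoc_graded R J I')"
    proof (intro equalityI subsetI)
      fix w assume "w \<in> h ` carrier (assoc_graded R J I)"
      then obtain u where u: "u \<in> carrier (assoc_graded R J I)" "w = h u" by blast
      then obtain x where x: "x \<in> ?D" "w = h (?c x)" "finite {n. ?c x n \<noteq> gr_filt R J I (n + 1)}"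
        unfolding carr by blast
      then show "w \<in> carrier (assoc_graded R J I')"
        unfolding carr' using h[OF x(1)] zero[OF x(1)] by auto
    next
      fix w assume "w \<in> carrier (assoc_graded R J I')"
      then obtain x where x: "x \<in> ?D" "w = ?c' x" "finite {n. ?c' x n \<noteq> gr_filt R J I' (n + 1)}"
        unfolding carr' by blast
      then have "?c x \<in> carrier (assoc_graded R J I)"
        unfolding carr using zero[OF x(1)] by auto
      then show "w \<in> h ` carrier (assoc_graded R J I)"
        unfolding x(2) h[OF x(1), symmetric] by (rule imageI)
    qed
  qed
  ultimately have iso: "h \<in> ring_iso (assoc_graded R J I) (assoc_graded R J I')"
    by (simp add: ring_iso_def)
  have zero_eq: "\<zero>\<^bsub>assoc_graded R J K\<^esub> k = gr_filt R J K (k + 1)" for K k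
    by (simp add: assoc_graded_def)
  have comp: "h u \<in> gr_component R J I' n \<longleftrightarrow> u \<in> gr_component R J I n"
    if u: "u \<in> carrier (assoc_graded R J I)" for u n
  proof -
    obtain x where x: "x \<in> ?D" "u = ?c x" using u unfolding carr by blast
    have "h u \<in> carrier (assoc_graded R J I')"
      using iso u by (auto simp: ring_iso_def bij_betw_def)
    then show ?thesis
      unfolding gr_component_def zero_eq mem_Collect_eq
      using u zero[OF x(1)] unfolding x(2) h[OF x(1)] by blast
  qed
  have "h ` gr_component R J I n = gr_component R J I' n" for n
  proof (intro equalityI subsetI)
    fix w assume "w \<in> h ` gr_component R J I n"
    then obtain u where u: "u \<in> gr_component R J I n" "w = h u" by blast
    then have "u \<in> carrier (assoc_graded R J I)" by (simp add: gr_component_def)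
    then show "w \<in> gr_component R J I' n" using comp u by simp
  next
    fix w assume w: "w \<in> gr_component R J I' n"
    then have "w \<in> h ` carrier (assoc_graded R J I)"
      using iso by (simp add: gr_component_def ring_iso_def bij_betw_def)
    then obtain u where u: "u \<in> carrier (assoc_graded R J I)" "w = h u" by blast
    then have "u \<in> gr_component R J I n" using comp w by simp
    then show "w \<in> h ` gr_component R J I n" unfolding u(2) by (rule imageI)
  qed
  then show ?thesis unfolding gr_isomorphic_def using iso by blast
qed

end

subsection \<open>The perturbation theorem\<close>

text \<open>For \<open>r \<ge> 3\<close> the term \<open>i = r\<close> of the maximum contains the
  full sum and a second \<open>a r\<close>.\<close>

lemma sum_le_loewy_bound:
  assumes "r \<ge> 1"
  shows "(\<Sum>i = 1..r. a i) \<le> loewy_bound r a"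
proof -
  consider "r = 1" | "r = 2" | "r \<ge> 3" using assms by linarith
  then show ?thesis
  proof cases
    case 3
    have "{1..r} = insert r {1..r - 1}" using 3 by auto
    then have "(\<Sum>i = 1..r. a i) \<le> (\<Sum>j = 1..r - 1. a j) + 2 * a r" using 3 by simp
    also have "\<dots> \<le> loewy_bound r a"
      unfolding loewy_bound_def using 3 by (auto intro!: Max_ge)
    finally show ?thesis .
  qed (auto simp: loewy_bound_def numeral_2_eq_2)
qed

theorem theorem3p5:
  fixes R :: "('a, 'b) ring_scheme" (structure)
    and \<mm> J I I' :: "'a set"
    and f f' \<epsilon> :: "nat \<Rightarrow> 'a"
    and a :: "nat \<Rightarrow> nat"
    and r N :: nat
  assumes "noetherian_local_ring R \<mm>"
    and "ideal J R" and "J \<noteq> carrier R"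
    and "r \<ge> 1"
    and "filter_regular R J f r"
    and "I = seq_ideal R f r"
    and "\<And>i. i \<in> {1..r} \<Longrightarrow> enat (a i) = colon_loewy R J f i"
    and "N = max (loewy_bound r a)
                 (Max ((\<lambda>i. artin_rees R J (seq_ideal R f i)) ` {1..r})) + 1"
    and "\<And>i. i \<in> {1..r} \<Longrightarrow> \<epsilon> i \<in> ideal_pow R J N"
    and "\<And>i. i \<in> {1..r} \<Longrightarrow> f' i = f i \<oplus> \<epsilon> i"
    and "I' = seq_ideal R f' r"
  shows "(filter_regular R J f' r \<and> (\<forall>i\<in>{1..r}. colon_loewy R J f' i = enat (a i)))
    \<and> (\<forall>i\<in>{1..r}. initial_ideal R J (seq_ideal R f' i) = initial_ideal R J (seq_ideal R f i))
    \<and> (initial_ideal R J I' = initial_ideal R J I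
       \<and> gr_isomorphic R J I' I
       \<and> artin_rees R J I' = artin_rees R J I)"
proof -
  interpret noetherian_local_ring_ideal R \<mm> J
    using assms(1-3) by (simp add: noetherian_local_ring_ideal_def noetherian_local_ring_ideal_axioms_def)
  have f: "f ` {1..r} \<subseteq> carrier R" using assms(5) by (simp add: filter_regular_def)
  have f': "f' ` {1..r} \<subseteq> carrier R"
  proof (rule image_subsetI)
    fix i assume i: "i \<in> {1..r}"
    then have "f i \<in> carrier R" using f by blast
    then show "f' i \<in> carrier R"
      using assms(10)[OF i] Jpow_carrier[OF assms(9)[OF i]] by simp
  qed
  have a: "annihilates f i (a i)" if i: "i \<in> {1..r}" for i
  proof -
    have "Inf {enat n | n. annihilates f i n} = enat (a i)"
      using assms(7)[OF i] colon_loewy_eq[OF J, of f i] f i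
      by (simp add: annihilates_def image_subset_iff)
    then show ?thesis by (rule Inf_enat_attained)
  qed
  have ar: "\<exists>c<N. ar_bound (seq_ideal R f i) c" if i: "i \<in> {1..r}" for i
  proof (intro exI conjI)
    show "ar_bound (seq_ideal R f i) (artin_rees R J (seq_ideal R f i))"
      using i by (intro ar_bound_artin_rees seq_ideal_ideal[OF f]) simp
    have "artin_rees R J (seq_ideal R f i) \<le> Max ((\<lambda>i. artin_rees R J (seq_ideal R f i)) ` {1..r})"
      using i by (intro Max_ge) auto
    then show "artin_rees R J (seq_ideal R f i) < N" unfolding assms(8) by linarith
  qed
  have N: "(\<Sum>i = 1..r. a i) < N"
    using sum_le_loewy_bound[OF assms(4), of a] unfolding assms(8) by linarith
  have perturb: "annihilates f' i = annihilates f i \<and> same_initial (seq_ideal R f i) (seq_ideal R f' i)"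
    if "i \<in> {1..r}" for i
    using that by (intro perturb_sequence[OF f a ar N assms(9,10)])
  have ann: "annihilates f' i = annihilates f i"
    and init: "same_initial (seq_ideal R f i) (seq_ideal R f' i)" if "i \<in> {1..r}" for i
    using perturb[OF that] by simp_all
  have loewy: "colon_loewy R J f' i = enat (a i)" if i: "i \<in> {1..r}" for i
  proof -
    have sub: "f ` {1..i} \<subseteq> carrier R" "f' ` {1..i} \<subseteq> carrier R" "1 \<le> i"
      using f f' i by (auto simp: image_subset_iff)
    show ?thesis
      unfolding assms(7)[OF i] colon_loewy_eq[OF J sub(1,3)] colon_loewy_eq[OF J sub(2,3)]
        annihilates_def[symmetric] ann[OF i] by (rule refl)
  qed
  have initial: "initial_ideal R J (seq_ideal R f' i) = initial_ideal R J (seq_ideal R f i)"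
    if "i \<in> {1..r}" for i
    using init[OF that] by (simp add: initial_ideal_def same_initial_def)
  have r: "r \<in> {1..r}" using assms(4) by simp
  have I: "ideal I R" and I': "ideal I' R"
    unfolding assms(6,11) by (rule seq_ideal_ideal[OF f order_refl] seq_ideal_ideal[OF f' order_refl])+
  have II': "same_initial I I'" using init[OF r] unfolding assms(6,11) .
  have "gr_isomorphic R J I' I"
    using II' by (intro gr_isomorphic_same_initial[OF J I' I]) (simp add: same_initial_def)
  moreover have "artin_rees R J I' = artin_rees R J I"
    using artin_rees_same_initial[OF I I' II'] by simp
  moreover have "filter_regular R J f' r"
    using f' loewy by (simp add: filter_regular_def)
  ultimately show ?thesis
    using loewy initial initial[OF r] unfolding assms(6,11) by blast
qed

end
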